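(* Let $\mathcal{E}_1,\mathcal{E}_2,\mathcal{G}$ be Hilbert spaces, let $F_1,\dots,F_N\in\mathcal{L}(\mathcal{G})$ be contractions, and let $G=[U\;\;V]\in\mathcal{L}(\mathcal{E}_1\oplus\mathcal{E}_2,\mathcal{G})$, $J=I_{\mathcal{E}_1}\oplus(-I_{\mathcal{E}_2})$. Assume that the wave operators $U_\infty$ and $V_\infty$ are bounded and that $\lim_{k\to\infty}\sum_{|\sigma|=k}\|F_\sigma^*g\|=0$ for all $g\in\mathcal{G}$. Let $$A=U_\infty^*U_\infty-V_\infty^*V_\infty$$ be the solution of the displacement equation $$A-\sum_{k=1}^NF_kAF_k^*=GJG^*.$$ Then $A$ is positive if and only if there exists $T\in\mathcal{S}(\mathcal{H},\mathcal{E}_1,\mathcal{E}_2)$ such that $V_\infty=TU_\infty$.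
   Context: Fix an integer $N\ge 1$ and $\mathcal{H}=\mathbb{C}^N$. $\mathbb{F}_N^+$ is the unital free semigroup of words on the letters $1,\dots,N$, $|\sigma|$ is the length of a word $\sigma$, and for $\sigma=i_1\cdots i_k$, $F_\sigma=F_{i_1}\cdots F_{i_k}$ (with $F_\emptyset=I$), $F_\sigma^*=(F_\sigma)^*$. $\mathcal{H}_k$ ($k\ge 0$) is the Hilbert space $\mathbb{C}^{N^k}$ with orthonormal basis $\{e_\sigma\}_{|\sigma|=k}$ listed in lexicographic order; for $k\ge1$, $\mathcal{H}_k$ is identified with the direct sum of $N$ copies of $\mathcal{H}_{k-1}$, the $j$-th copy being spanned by the $e_{j\sigma}$, $|\sigma|=k-1$ ($e_{j\sigma}$ corresponding to $e_\sigma$ in the $j$-th copy); correspondingly $\mathcal{H}_k\otimes\mathcal{E}=(\mathcal{H}_{k-1}\otimes\mathcal{E})^{\oplus N}$ for a Hilbert space $\mathcal{E}$. $R^{\oplus N}$ is the direct sum of $N$ copies of an operator $R$. $\mathcal{S}(\mathcal{H},\mathcal{E}_1,\mathcal{E}_2)$ is the set of contractions $T=[T_{ij}]_{i,j=0}^\infty$ from $\bigoplus_{k=0}^\infty(\mathcal{H}_k\otimes\mathcal{E}_1)$ to $\bigoplus_{k=0}^\infty(\mathcal{H}_k\otimes\mathcal{E}_2)$, with $T_{ij}:\mathcal{H}_j\otimes\mathcal{E}_1\to\mathcal{H}_i\otimes\mathcal{E}_2$, that are upper triangular ($T_{ij}=0$ for $i>j$) and satisfy $T_{ij}=T_{i-1,j-1}^{\oplus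 N}$ for $1\le i\le j$. The wave operators $U_\infty:\mathcal{G}\to\bigoplus_{k=0}^\infty(\mathcal{H}_k\otimes\mathcal{E}_1)$ and $V_\infty:\mathcal{G}\to\bigoplus_{k=0}^\infty(\mathcal{H}_k\otimes\mathcal{E}_2)$ are defined by $U_\infty^*=[U_k]_{k=0}^\infty$, $V_\infty^*=[V_k]_{k=0}^\infty$ (row operators), where $U_k=[F_\sigma U]_{|\sigma|=k}:\mathcal{H}_k\otimes\mathcal{E}_1\to\mathcal{G}$ and $V_k=[F_\sigma V]_{|\sigma|=k}:\mathcal{H}_k\otimes\mathcal{E}_2\to\mathcal{G}$ are the row operators indexed by the words of length $k$ in lexicographic order. Under the stated assumptions, $A=U_\infty^*U_\infty-V_\infty^*V_\infty$ is the unique solution of the displacement equation. *)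

theory Defs
  imports "HOL-Analysis.Analysis"
begin

section \<open>Complex Hilbert spaces\<close>

text \<open>The distribution only has real inner product spaces.  A complex one is rendered as a
  \<^class>\<open>real_inner\<close> space with a complex structure whose Hermitian form, linear in its first
  argument, has the given real inner product as its real part.  In particular the norm is
  the one of the Hermitian form.\<close>

class complex_inner = real_inner +
  fixes scaleC :: "complex \<Rightarrow> 'a \<Rightarrow> 'a"  (infixr \<open>*\<^sub>C\<close> 75)
    and cinner :: "'a \<Rightarrow> 'a \<Rightarrow> complex"
  assumes scaleC_add_right: "c *\<^sub>C (x + y) = c *\<^sub>C x + c *\<^sub>C y"
    and scaleC_add_left: "(c + d) *\<^sub>C x = c *\<^sub>C x + d *\<^sub>C x"
    and scaleC_scaleC: "c *\<^sub>C d *\<^sub>C x = (c * d) *\<^sub>C x"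
    and scaleR_scaleC: "scaleR r x = complex_of_real r *\<^sub>C x"
    and cinner_commute: "cinner x y = cnj (cinner y x)"
    and cinner_add_left: "cinner (x + y) z = cinner x z + cinner y z"
    and cinner_scaleC_left: "cinner (c *\<^sub>C x) y = c * cinner x y"
    and Re_cinner: "Re (cinner x y) = inner x y"

class chilbert_space = complex_inner + banach

lemma cinner_self: "cinner x x = complex_of_real ((norm x)\<^sup>2)"
  for x :: "'a::complex_inner"
proof (rule complex_eqI)
  show "Re (cinner x x) = Re (complex_of_real ((norm x)\<^sup>2))"
    by (simp add: Re_cinner dot_square_norm)
  show "Im (cinner x x) = Im (complex_of_real ((norm x)\<^sup>2))"
    using arg_cong[OF cinner_commute[of x x], of Im] by simp
qed

lemma norm_scaleC: "norm (c *\<^sub>C x) = cmod c * norm x"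
  for x :: "'a::complex_inner"
proof -
  have "cinner (c *\<^sub>C x) (c *\<^sub>C x) = c * cnj (c * cinner x x)"
    by (metis cinner_scaleC_left cinner_commute)
  also have "\<dots> = complex_of_real ((cmod c * norm x)\<^sup>2)"
    unfolding cinner_self
    by (simp add: power_mult_distrib complex_norm_square mult.assoc[symmetric] del: of_real_power)
  finally have "(norm (c *\<^sub>C x))\<^sup>2 = (cmod c * norm x)\<^sup>2"
    unfolding cinner_self of_real_eq_iff .
  then show ?thesis by (simp add: power2_eq_iff_nonneg)
qed

lemma cinner_bound: "cmod (cinner x y) \<le> norm x * norm y"
  for x y :: "'a::complex_inner"
proof (cases "cinner x y = 0")
  case False
  define c where "c = cnj (sgn (cinner x y))"
  have c: "cmod c = 1" using False by (simp add: c_def norm_sgn)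
  have "c * cinner x y = complex_of_real (cmod (cinner x y))"
    using False unfolding c_def sgn_eq
    by (simp add: field_simps complex_norm_square[symmetric] power2_eq_square)
  then have "cmod (cinner x y) = Re (cinner (c *\<^sub>C x) y)"
    by (simp add: cinner_scaleC_left)
  also have "\<dots> \<le> norm (c *\<^sub>C x) * norm y"
    unfolding Re_cinner by (rule norm_cauchy_schwarz)
  finally show ?thesis by (simp add: norm_scaleC c)
qed simp

instantiation complex :: chilbert_space
begin

definition "scaleC_complex c (x::complex) = c * x"
definition "cinner_complex (x::complex) y = x * cnj y"

instance
  by standard
    (simp_all add: scaleC_complex_def cinner_complex_def inner_complex_def algebra_simps
      scaleR_conv_of_real)

end

instantiation prod :: (complex_inner, complex_inner) complex_inner
begin

definition "scaleC_prod c (x::'a \<times> 'b) = (c *\<^sub>C fst x, c *\<^sub>C snd x)"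
definition "cinner_prod (x::'a \<times> 'b) y = cinner (fst x) (fst y) + cinner (snd x) (snd y)"

instance
proof
  fix x y :: "'a \<times> 'b"
  show "cinner x y = cnj (cinner y x)"
    unfolding cinner_prod_def complex_cnj_add by (metis cinner_commute)
qed (auto simp: scaleC_prod_def cinner_prod_def inner_prod_def scaleC_add_right scaleC_add_left
      scaleC_scaleC scaleR_scaleC cinner_add_left cinner_scaleC_left Re_cinner algebra_simps
      prod_eq_iff)

end

instance prod :: (chilbert_space, chilbert_space) chilbert_space ..

section \<open>Hilbert space direct sums of copies of a Hilbert space\<close>

typedef (overloaded) ('i, 'e::real_inner) l2 =
    "{f :: 'i \<Rightarrow> 'e. (\<lambda>i. (norm (f i))\<^sup>2) summable_on UNIV}"
  morphisms coord Abs_l2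
  by (rule exI[of _ "\<lambda>_. 0"]) simp

setup_lifting type_definition_l2

lemma l2_summable: "(\<lambda>i. (norm (coord f i))\<^sup>2) summable_on UNIV"
  using coord[of f] by simp

lemma l2_eqI: "(\<And>i. coord f i = coord g i) \<Longrightarrow> f = g"
  by (simp add: coord_inject[symmetric] fun_eq_iff)

lemma sq_summable_add:
  fixes f g :: "'i \<Rightarrow> 'e::real_inner"
  assumes "(\<lambda>i. (norm (f i))\<^sup>2) summable_on UNIV" "(\<lambda>i. (norm (g i))\<^sup>2) summable_on UNIV"
  shows "(\<lambda>i. (norm (f i + g i))\<^sup>2) summable_on UNIV"
proof (rule summable_on_comparison_test)
  show "(\<lambda>i. 2 * ((norm (f i))\<^sup>2 + (norm (g i))\<^sup>2)) summable_on UNIV"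
    by (intro summable_on_cmult_right summable_on_add assms)
  fix i
  have "(norm (f i + g i))\<^sup>2 \<le> (norm (f i) + norm (g i))\<^sup>2"
    by (simp add: norm_triangle_ineq power_mono)
  also have "\<dots> \<le> 2 * ((norm (f i))\<^sup>2 + (norm (g i))\<^sup>2)"
    using sum_squares_bound[of "norm (f i)" "norm (g i)"] by (simp add: power2_sum)
  finally show "(norm (f i + g i))\<^sup>2 \<le> 2 * ((norm (f i))\<^sup>2 + (norm (g i))\<^sup>2)" .
qed simp

lemma sq_summable_scale:
  fixes f :: "'i \<Rightarrow> 'e::real_inner" and g :: "'i \<Rightarrow> 'b::real_inner"
  assumes "(\<lambda>i. (norm (f i))\<^sup>2) summable_on UNIV" "\<And>i. norm (g i) = r * norm (f i)"
  shows "(\<lambda>i. (norm (g i))\<^sup>2) summable_on UNIV"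
  using summable_on_cmult_right[OF assms(1), of "r\<^sup>2"] by (simp add: assms(2) power_mult_distrib)

lemma sq_summable_prod:
  fixes f g :: "'i \<Rightarrow> 'e::real_inner"
  assumes "(\<lambda>i. (norm (f i))\<^sup>2) summable_on UNIV" "(\<lambda>i. (norm (g i))\<^sup>2) summable_on UNIV"
  shows "(\<lambda>i. norm (f i) * norm (g i)) summable_on UNIV"
proof (rule summable_on_comparison_test)
  show "(\<lambda>i. (norm (f i))\<^sup>2 + (norm (g i))\<^sup>2) summable_on UNIV"
    by (intro summable_on_add assms)
  show "norm (f i) * norm (g i) \<le> (norm (f i))\<^sup>2 + (norm (g i))\<^sup>2" for i
    using sum_squares_bound[of "norm (f i)" "norm (g i)"] zero_le_power2[of "norm (f i)"]
      zero_le_power2[of "norm (g i)"] mult_nonneg_nonneg[of "norm (f i)" "norm (g i)"]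
    by linarith
qed simp

lemma l2_inner_summable: "(\<lambda>i. inner (coord f i) (coord g i)) summable_on UNIV"
proof (rule abs_summable_summable)
  show "(\<lambda>i. norm (inner (coord f i) (coord g i))) summable_on UNIV"
    by (rule summable_on_comparison_test[OF sq_summable_prod[OF l2_summable[of f] l2_summable[of g]]])
      (auto simp: Cauchy_Schwarz_ineq2)
qed

lemma l2_cinner_summable: "(\<lambda>i. cinner (coord f i) (coord g i)) summable_on UNIV"
  for f g :: "('i, 'e::complex_inner) l2"
proof (rule abs_summable_summable)
  show "(\<lambda>i. norm (cinner (coord f i) (coord g i))) summable_on UNIV"
    by (rule summable_on_comparison_test[OF sq_summable_prod[OF l2_summable[of f] l2_summable[of g]]])
      (auto simp: cinner_bound)
qed

instantiation l2 :: (type, real_inner) real_inner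
begin

lift_definition zero_l2 :: "('a, 'b) l2" is "\<lambda>_. 0" by simp

lift_definition plus_l2 :: "('a, 'b) l2 \<Rightarrow> ('a, 'b) l2 \<Rightarrow> ('a, 'b) l2"
  is "\<lambda>f g i. f i + g i" by (rule sq_summable_add)

lift_definition uminus_l2 :: "('a, 'b) l2 \<Rightarrow> ('a, 'b) l2" is "\<lambda>f i. - f i" by simp

lift_definition minus_l2 :: "('a, 'b) l2 \<Rightarrow> ('a, 'b) l2 \<Rightarrow> ('a, 'b) l2"
  is "\<lambda>f g i. f i - g i"
  subgoal for f g using sq_summable_add[of f "\<lambda>i. - g i"] by simp
  done

lift_definition scaleR_l2 :: "real \<Rightarrow> ('a, 'b) l2 \<Rightarrow> ('a, 'b) l2"
  is "\<lambda>r f i. scaleR r (f i)"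
  subgoal for r f by (rule sq_summable_scale[where r = "\<bar>r\<bar>"]) auto
  done

definition inner_l2 :: "('a, 'b) l2 \<Rightarrow> ('a, 'b) l2 \<Rightarrow> real"
  where "inner_l2 f g = (\<Sum>\<^sub>\<infinity>i. inner (coord f i) (coord g i))"

definition norm_l2 :: "('a, 'b) l2 \<Rightarrow> real" where "norm_l2 f = sqrt (inner f f)"
definition sgn_l2 :: "('a, 'b) l2 \<Rightarrow> ('a, 'b) l2" where "sgn_l2 f = scaleR (inverse (norm f)) f"
definition dist_l2 :: "('a, 'b) l2 \<Rightarrow> ('a, 'b) l2 \<Rightarrow> real" where "dist_l2 f g = norm (f - g)"
definition uniformity_l2 :: "(('a, 'b) l2 \<times> ('a, 'b) l2) filter"
  where "uniformity_l2 = (INF e\<in>{0<..}. principal {(f, g). dist f g < e})"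
definition open_l2 :: "('a, 'b) l2 set \<Rightarrow> bool"
  where "open_l2 S = (\<forall>f\<in>S. \<forall>\<^sub>F (f', g) in uniformity. f' = f \<longrightarrow> g \<in> S)"

instance
proof
  fix f g h :: "('a, 'b) l2" and r s :: real
  show "f + g + h = f + (g + h)" "f + g = g + f" "0 + f = f" "- f + f = 0" "f - g = f + - g"
    "r *\<^sub>R (f + g) = r *\<^sub>R f + r *\<^sub>R g" "(r + s) *\<^sub>R f = r *\<^sub>R f + s *\<^sub>R f"
    "r *\<^sub>R s *\<^sub>R f = (r * s) *\<^sub>R f" "1 *\<^sub>R f = f"
    by (transfer, simp add: fun_eq_iff algebra_simps)+
  show "inner f g = inner g f"
    by (simp add: inner_l2_def inner_commute)
  show "inner (f + g) h = inner f h + inner g h"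
    by (simp add: inner_l2_def plus_l2.rep_eq inner_add_left infsum_add l2_inner_summable)
  show "inner (r *\<^sub>R f) g = r * inner f g"
    by (simp add: inner_l2_def scaleR_l2.rep_eq infsum_cmult_right')
  show "0 \<le> inner f f"
    by (simp add: inner_l2_def infsum_nonneg)
  show "inner f f = 0 \<longleftrightarrow> f = 0"
  proof
    assume "inner f f = 0"
    then have "inner (coord f i) (coord f i) = 0" for i
      using nonneg_infsum_le_0D[of "\<lambda>i. inner (coord f i) (coord f i)" UNIV i]
      by (simp add: inner_l2_def l2_inner_summable)
    then show "f = 0" by (intro l2_eqI) (simp add: zero_l2.rep_eq)
  qed (simp add: inner_l2_def zero_l2.rep_eq)
qed (simp_all add: norm_l2_def sgn_l2_def dist_l2_def uniformity_l2_def open_l2_def)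

end

lemma norm_l2_sq: "(norm f)\<^sup>2 = (\<Sum>\<^sub>\<infinity>i. (norm (coord f i))\<^sup>2)"
  for f :: "('i, 'e::real_inner) l2"
  by (simp add: power2_norm_eq_inner inner_l2_def)

instantiation l2 :: (type, complex_inner) complex_inner
begin

lift_definition scaleC_l2 :: "complex \<Rightarrow> ('a, 'b) l2 \<Rightarrow> ('a, 'b) l2"
  is "\<lambda>c f i. c *\<^sub>C f i"
  subgoal for c f by (rule sq_summable_scale[where r = "cmod c"]) (auto simp: norm_scaleC)
  done

definition cinner_l2 :: "('a, 'b) l2 \<Rightarrow> ('a, 'b) l2 \<Rightarrow> complex"
  where "cinner_l2 f g = (\<Sum>\<^sub>\<infinity>i. cinner (coord f i) (coord g i))"

instance
proof
  fix f g h :: "('a, 'b) l2" and c d :: complex and r :: real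
  show "c *\<^sub>C (f + g) = c *\<^sub>C f + c *\<^sub>C g" "(c + d) *\<^sub>C f = c *\<^sub>C f + d *\<^sub>C f"
    "c *\<^sub>C d *\<^sub>C f = (c * d) *\<^sub>C f" "r *\<^sub>R f = complex_of_real r *\<^sub>C f"
    by (transfer, simp add: fun_eq_iff scaleC_add_right scaleC_add_left scaleC_scaleC
        scaleR_scaleC)+
  show "cinner f g = cnj (cinner g f)"
    unfolding cinner_l2_def infsum_cnj[symmetric] by (metis cinner_commute)
  show "cinner (f + g) h = cinner f h + cinner g h"
    by (simp add: cinner_l2_def plus_l2.rep_eq cinner_add_left infsum_add l2_cinner_summable)
  show "cinner (c *\<^sub>C f) g = c * cinner f g"
    by (simp add: cinner_l2_def scaleC_l2.rep_eq cinner_scaleC_left infsum_cmult_right')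
  show "Re (cinner f g) = inner f g"
    by (simp add: cinner_l2_def inner_l2_def infsum_Re[OF l2_cinner_summable, symmetric] Re_cinner)
qed

end

lemma norm_coord_le: "norm (coord f i) \<le> norm f"
proof -
  have "(norm (coord f i))\<^sup>2 \<le> (norm f)\<^sup>2"
    unfolding norm_l2_sq
    using finite_sum_le_infsum[OF l2_summable[of f], of "{i}"] by simp
  then show ?thesis by (simp add: power2_le_iff_abs_le)
qed

instance l2 :: (type, "{real_inner, complete_space}") complete_space
proof
  fix X :: "nat \<Rightarrow> ('a, 'b) l2"
  assume X: "Cauchy X"
  have "Cauchy (\<lambda>n. coord (X n) i)" for i
  proof (rule metric_CauchyI)
    fix e :: real assume "0 < e"
    with X obtain M where M: "\<And>m n. m \<ge> M \<Longrightarrow> n \<ge> M \<Longrightarrow> dist (X m) (X n) < e"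
      by (meson metric_CauchyD)
    show "\<exists>M. \<forall>m\<ge>M. \<forall>n\<ge>M. dist (coord (X m) i) (coord (X n) i) < e"
    proof (intro exI allI impI)
      fix m n assume "M \<le> m" "M \<le> n"
      have "dist (coord (X m) i) (coord (X n) i) = norm (coord (X m - X n) i)"
        by (simp add: dist_norm minus_l2.rep_eq)
      also have "\<dots> \<le> dist (X m) (X n)" by (simp add: dist_norm norm_coord_le)
      also have "\<dots> < e" using M \<open>M \<le> m\<close> \<open>M \<le> n\<close> by blast
      finally show "dist (coord (X m) i) (coord (X n) i) < e" .
    qed
  qed
  then have "\<exists>l. (\<lambda>n. coord (X n) i) \<longlonglongrightarrow> l" for i
    by (simp add: Cauchy_convergent convergent_def[symmetric])
  then obtain x where x: "\<And>i. (\<lambda>n. coord (X n) i) \<longlonglongrightarrow> x i" by metis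
  have tail: "(\<Sum>i\<in>S. (norm (coord (X m) i - x i))\<^sup>2) \<le> e\<^sup>2"
    if "finite S" "0 < e" "\<And>n. n \<ge> M \<Longrightarrow> dist (X m) (X n) < e" for S e m M
  proof (rule LIMSEQ_le_const2)
    show "(\<lambda>n. \<Sum>i\<in>S. (norm (coord (X m) i - coord (X n) i))\<^sup>2)
        \<longlonglongrightarrow> (\<Sum>i\<in>S. (norm (coord (X m) i - x i))\<^sup>2)"
      by (intro tendsto_intros x)
    show "\<exists>N. \<forall>n\<ge>N. (\<Sum>i\<in>S. (norm (coord (X m) i - coord (X n) i))\<^sup>2) \<le> e\<^sup>2"
    proof (intro exI allI impI)
      fix n assume "M \<le> n"
      have "(\<Sum>i\<in>S. (norm (coord (X m) i - coord (X n) i))\<^sup>2)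
          = (\<Sum>i\<in>S. (norm (coord (X m - X n) i))\<^sup>2)"
        by (simp add: minus_l2.rep_eq)
      also have "\<dots> \<le> (norm (X m - X n))\<^sup>2"
        unfolding norm_l2_sq by (rule finite_sum_le_infsum[OF l2_summable \<open>finite S\<close>]) auto
      also have "\<dots> \<le> e\<^sup>2"
        using that(3)[OF \<open>M \<le> n\<close>] by (simp add: dist_norm power_mono)
      finally show "(\<Sum>i\<in>S. (norm (coord (X m) i - coord (X n) i))\<^sup>2) \<le> e\<^sup>2" .
    qed
  qed
  have diff_summable: "(\<lambda>i. (norm (coord (X m) i - x i))\<^sup>2) summable_on UNIV"
    if "0 < e" "\<And>n. n \<ge> M \<Longrightarrow> dist (X m) (X n) < e" for e m M
    by (rule nonneg_bdd_above_summable_on) (auto intro!: bdd_aboveI[where M = "e\<^sup>2"] tail that)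
  obtain M0 where M0: "\<And>m n. m \<ge> M0 \<Longrightarrow> n \<ge> M0 \<Longrightarrow> dist (X m) (X n) < 1"
    using metric_CauchyD[OF X, of 1] by auto
  have "(\<lambda>i. (norm (coord (X M0) i - x i))\<^sup>2) summable_on UNIV"
    by (rule diff_summable[of 1 M0]) (auto intro: M0)
  then have "(\<lambda>i. (norm (x i - coord (X M0) i))\<^sup>2) summable_on UNIV"
    by (simp add: norm_minus_commute)
  from sq_summable_add[OF this l2_summable[of "X M0"]]
  have "(\<lambda>i. (norm (x i))\<^sup>2) summable_on UNIV" by simp
  then have cx: "coord (Abs_l2 x) = x" by (simp add: Abs_l2_inverse)
  have "X \<longlonglongrightarrow> Abs_l2 x"
  proof (rule metric_LIMSEQ_I)
    fix r :: real assume "0 < r"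
    then have r: "0 < r / 2" by simp
    from metric_CauchyD[OF X r] obtain M
      where M: "\<And>m n. m \<ge> M \<Longrightarrow> n \<ge> M \<Longrightarrow> dist (X m) (X n) < r / 2" by blast
    show "\<exists>M. \<forall>n\<ge>M. dist (X n) (Abs_l2 x) < r"
    proof (intro exI allI impI)
      fix m assume m: "M \<le> m"
      have "(norm (X m - Abs_l2 x))\<^sup>2 \<le> (r / 2)\<^sup>2"
        unfolding norm_l2_sq
      proof (rule infsum_le_finite_sums[OF l2_summable])
        fix S :: "'a set" assume "finite S"
        from tail[OF this r M[OF m]]
        show "(\<Sum>i\<in>S. (norm (coord (X m - Abs_l2 x) i))\<^sup>2) \<le> (r / 2)\<^sup>2"
          by (simp add: minus_l2.rep_eq cx)
      qed
      then have "norm (X m - Abs_l2 x) \<le> r / 2"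
        using r by (simp add: power2_le_iff_abs_le del: half_gt_zero_iff)
      then show "dist (X m) (Abs_l2 x) < r" using \<open>0 < r\<close> by (simp add: dist_norm)
    qed
  qed
  then show "convergent X" by (auto simp: convergent_def)
qed

instance l2 :: (type, "{real_inner, banach}") banach ..

instance l2 :: (type, chilbert_space) chilbert_space ..

section \<open>Operators\<close>

definition bounded_clinear :: "('a::complex_inner \<Rightarrow> 'b::complex_inner) \<Rightarrow> bool" where
  "bounded_clinear f \<longleftrightarrow> bounded_linear f \<and> (\<forall>c x. f (c *\<^sub>C x) = c *\<^sub>C f x)"

definition contraction :: "('a::complex_inner \<Rightarrow> 'b::complex_inner) \<Rightarrow> bool" where
  "contraction f \<longleftrightarrow> bounded_clinear f \<and> (\<forall>x. norm (f x) \<le> norm x)"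

text \<open>On Hilbert spaces the adjoint of a bounded operator exists and is unique; the value on
  other functions is irrelevant.\<close>

definition cadjoint :: "('a::complex_inner \<Rightarrow> 'b::complex_inner) \<Rightarrow> 'b \<Rightarrow> 'a" where
  "cadjoint f = (SOME g. \<forall>x y. cinner (f x) y = cinner x (g y))"

definition positive_op :: "('a::complex_inner \<Rightarrow> 'a) \<Rightarrow> bool" where
  "positive_op A \<longleftrightarrow> bounded_clinear A \<and>
     (\<forall>x. cinner (A x) x \<in> \<real> \<and> 0 \<le> Re (cinner (A x) x))"

fun word_op :: "('n \<Rightarrow> 'g \<Rightarrow> 'g) \<Rightarrow> 'n list \<Rightarrow> 'g \<Rightarrow> 'g" where
  "word_op F [] = id"
| "word_op F (i # \<sigma>) = F i \<circ> word_op F \<sigma>"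

section \<open>The direct sum of the spaces \<open>H\<^sub>k \<otimes> E\<close>\<close>

text \<open>The letters are the elements of a finite type \<open>'n\<close> (so that \<open>N = CARD('n) \<ge> 1\<close>) and words
  are lists of letters.  A vector of the direct sum over \<open>k\<close> of the spaces \<open>H\<^sub>k \<otimes> E\<close> is identified
  with the square summable family of its coefficients in \<open>E\<close> with respect to the orthonormal
  vectors \<open>e\<^sub>\<sigma>\<close>; the summand \<open>H\<^sub>k \<otimes> E\<close> is the subspace of the families supported on the words of
  length \<open>k\<close>.\<close>

type_synonym ('n, 'e) fock = "('n list, 'e) l2"

lift_definition degree_proj :: "nat \<Rightarrow> ('n, 'e::real_inner) fock \<Rightarrow> ('n, 'e) fock"
  is "\<lambda>k f \<sigma>. if length \<sigma> = k then f \<sigma> else 0"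
  subgoal for k f by (rule summable_on_comparison_test[where f = "\<lambda>\<sigma>. (norm (f \<sigma>))\<^sup>2"]) auto
  done

text \<open>\<open>branch j\<close> extracts the component of a vector in the \<open>j\<close>-th copy of \<open>H\<^sub>k\<^sub>-\<^sub>1 \<otimes> E\<close> inside
  \<open>H\<^sub>k \<otimes> E\<close>, for all \<open>k \<ge> 1\<close> at once, and \<open>join\<close> assembles a vector from such components.\<close>

lift_definition branch :: "'n \<Rightarrow> ('n, 'e::real_inner) fock \<Rightarrow> ('n, 'e) fock"
  is "\<lambda>j f \<sigma>. f (j # \<sigma>)"
  subgoal for j f
    using summable_on_subset_banach[of "\<lambda>\<sigma>. (norm (f \<sigma>))\<^sup>2" UNIV "range ((#) j)"]
    by (simp add: summable_on_reindex o_def)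
  done

lift_definition join :: "('n::finite \<Rightarrow> ('n, 'e::real_inner) fock) \<Rightarrow> ('n, 'e) fock"
  is "\<lambda>h \<sigma>. case \<sigma> of [] \<Rightarrow> 0 | j # \<tau> \<Rightarrow> h j \<tau>"
proof -
  fix h :: "'n \<Rightarrow> 'n list \<Rightarrow> 'e"
  assume h: "\<And>j. (\<lambda>\<tau>. (norm (h j \<tau>))\<^sup>2) summable_on UNIV"
  let ?f = "\<lambda>\<sigma>. (norm (case \<sigma> of [] \<Rightarrow> 0 | j # \<tau> \<Rightarrow> h j \<tau>))\<^sup>2"
  have "?f summable_on range ((#) j)" for j
    using h[of j] by (simp add: summable_on_reindex o_def)
  then have "?f summable_on (\<Union>j. range ((#) j))"
    by (intro summable_on_finite_union_disjoint) auto
  then have "?f summable_on insert [] (\<Union>j. range ((#) j))"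
    by (simp add: summable_on_insert_iff)
  also have "insert [] (\<Union>j. range ((#) j)) = UNIV"
    by (auto simp: image_iff) (metis list.exhaust)
  finally show "?f summable_on UNIV" .
qed

definition ampliation ::
    "(('n, 'e1::real_inner) fock \<Rightarrow> ('n, 'e2::real_inner) fock)
      \<Rightarrow> ('n::finite, 'e1) fock \<Rightarrow> ('n, 'e2) fock" where
  "ampliation R f = join (\<lambda>j. R (branch j f))"

text \<open>The matrix entry \<open>T\<^sub>i\<^sub>j\<close> from \<open>H\<^sub>j \<otimes> E\<^sub>1\<close> to \<open>H\<^sub>i \<otimes> E\<^sub>2\<close>, regarded as an operator on the whole
  space by extending it by zero on the orthogonal complement of \<open>H\<^sub>j \<otimes> E\<^sub>1\<close>.\<close>

definition entry ::
    "(('n, 'e1::real_inner) fock \<Rightarrow> ('n, 'e2::real_inner) fock)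
      \<Rightarrow> nat \<Rightarrow> nat \<Rightarrow> ('n, 'e1) fock \<Rightarrow> ('n, 'e2) fock" where
  "entry T i j = degree_proj i \<circ> T \<circ> degree_proj j"

definition schur_class ::
    "(('n::finite, 'e1::complex_inner) fock \<Rightarrow> ('n, 'e2::complex_inner) fock) set" where
  "schur_class = {T. contraction T \<and>
     (\<forall>i j. j < i \<longrightarrow> entry T i j = (\<lambda>_. 0)) \<and>
     (\<forall>i j. 1 \<le> i \<and> i \<le> j \<longrightarrow> entry T i j = ampliation (entry T (i - 1) (j - 1)))}"

section \<open>Wave operators\<close>

definition word_row ::
    "('n::finite \<Rightarrow> 'g \<Rightarrow> 'g::complex_inner) \<Rightarrow> ('e::complex_inner \<Rightarrow> 'g) \<Rightarrow> nat
      \<Rightarrow> ('n, 'e) fock \<Rightarrow> 'g" where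
  "word_row F U k f = (\<Sum>\<sigma> | length \<sigma> = k. word_op F \<sigma> (U (coord f \<sigma>)))"

text \<open>\<open>W\<close> is the wave operator of \<open>(F, U)\<close> and is bounded: its adjoint acts on each \<open>H\<^sub>k \<otimes> E\<close>
  as the row operator \<open>[F\<^sub>\<sigma> U]\<close>, \<open>|\<sigma>| = k\<close>.  As the spaces \<open>H\<^sub>k \<otimes> E\<close> span a dense subspace, there is
  at most one such \<open>W\<close>, and there is one iff the row operator is bounded.\<close>

definition bounded_wave_operator ::
    "('n::finite \<Rightarrow> 'g \<Rightarrow> 'g::complex_inner) \<Rightarrow> ('e::complex_inner \<Rightarrow> 'g)
      \<Rightarrow> ('g \<Rightarrow> ('n, 'e) fock) \<Rightarrow> bool" where
  "bounded_wave_operator F U W \<longleftrightarrow> bounded_clinear W \<and>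
     (\<forall>k f. cadjoint W (degree_proj k f) = word_row F U k f)"

definition signature_op :: "'a \<times> 'b \<Rightarrow> 'a \<times> 'b::ab_group_add" where
  "signature_op = (\<lambda>(x, y). (x, - y))"

definition solves_displacement ::
    "('n::finite \<Rightarrow> 'g \<Rightarrow> 'g::complex_inner)
      \<Rightarrow> ('e1::complex_inner \<times> 'e2::complex_inner \<Rightarrow> 'g) \<Rightarrow> ('g \<Rightarrow> 'g) \<Rightarrow> bool" where
  "solves_displacement F G A \<longleftrightarrow> bounded_clinear A \<and>
     (\<forall>g. A g - (\<Sum>k\<in>UNIV. F k (A (cadjoint (F k) g))) = G (signature_op (cadjoint G g)))"

end

theory Submission
  imports Defs
begin

text \<open>The wave operators satisfy \<open>U\<^sub>\<infinity>\<^sup>*U\<^sub>\<infinity> = UU\<^sup>* + \<Sum>\<^sub>k F\<^sub>k U\<^sub>\<infinity>\<^sup>*U\<^sub>\<infinity> F\<^sub>k\<^sup>*\<close>, so \<open>A\<close> solves the displacement equation;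
  a solution of the homogeneous equation is \<open>\<Sum>\<^sub>\<sigma> F\<^sub>\<sigma> D F\<^sub>\<sigma>\<^sup>*\<close> with \<open>\<bar>\<sigma>\<bar> = n\<close> for every \<open>n\<close>, hence zero.  If
  \<open>V\<^sub>\<infinity> = T U\<^sub>\<infinity>\<close> with a contraction \<open>T\<close> then clearly \<open>A \<ge> 0\<close>.  Conversely, factor \<open>A = h\<^sup>*h\<close>.  The
  displacement equation says that \<open>((h F\<^sub>k\<^sup>* g)\<^sub>k, U\<^sup>* g) \<mapsto> (h g, V\<^sup>* g)\<close> is isometric (a lurking
  isometry), so it extends to a contraction, which is the colligation of a linear system indexed by
  words; its transfer operator \<open>T\<close> lies in the Schur class and maps \<open>U\<^sub>\<infinity> g\<close> to \<open>V\<^sub>\<infinity> g\<close>, the error after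
  truncation at depth \<open>m\<close> being at most the tail of \<open>U\<^sub>\<infinity> g\<close> beyond depth \<open>m\<close>.\<close>

section \<open>Bounded operators and adjoints\<close>

lemma bounded_clinear_linear: "bounded_clinear f \<Longrightarrow> linear f"
  unfolding bounded_clinear_def using bounded_linear.linear by blast

lemma bounded_clinearI:
  fixes f :: "'a::complex_inner \<Rightarrow> 'b::complex_inner"
  assumes "\<And>x y. f (x + y) = f x + f y" "\<And>c x. f (c *\<^sub>C x) = c *\<^sub>C f x"
    and "\<And>x. norm (f x) \<le> K * norm x"
  shows "bounded_clinear f"
  unfolding bounded_clinear_def
proof
  show "bounded_linear f"
    by (rule bounded_linear_intro[of _ K]) (auto simp: assms scaleR_scaleC mult.commute)
qed (simp add: assms)

lemma bounded_clinear_bound: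
  assumes "bounded_clinear f"
  obtains K where "0 < K" "\<And>x. norm (f x) \<le> K * norm x"
  using assms unfolding bounded_clinear_def
  by (metis bounded_linear.pos_bounded mult.commute)

lemma bounded_clinear_add: "bounded_clinear f \<Longrightarrow> f (x + y) = f x + f y"
  and bounded_clinear_diff: "bounded_clinear f \<Longrightarrow> f (x - y) = f x - f y"
  and bounded_clinear_0: "bounded_clinear f \<Longrightarrow> f 0 = 0"
  and bounded_clinear_scaleR: "bounded_clinear f \<Longrightarrow> f (r *\<^sub>R x) = r *\<^sub>R f x"
  and bounded_clinear_scaleC: "bounded_clinear f \<Longrightarrow> f (c *\<^sub>C x) = c *\<^sub>C f x"
  by (simp_all add: bounded_clinear_linear linear_add linear_diff linear_0 linear_scale)
    (simp add: bounded_clinear_def)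

lemma bounded_clinear_id: "bounded_clinear (\<lambda>x. x)"
  by (rule bounded_clinearI[where K = 1]) auto

section \<open>Complex scalars, and closure properties of bounded operators\<close>

lemma scaleC_zero_right: "c *\<^sub>C (0::'a::complex_inner) = 0"
  using scaleC_add_right[of c "0::'a" 0] by simp

lemma scaleC_minus_right: "c *\<^sub>C (- x) = - (c *\<^sub>C (x::'a::complex_inner))"
  using scaleC_add_right[of c x "- x"] by (simp add: scaleC_zero_right eq_neg_iff_add_eq_0 add.commute)

lemma scaleC_diff_right: "c *\<^sub>C (x - y) = c *\<^sub>C x - c *\<^sub>C (y::'a::complex_inner)"
  using scaleC_add_right[of c x "- y"] by (simp add: scaleC_minus_right)

lemma scaleC_scaleR: "c *\<^sub>C (r *\<^sub>R x) = r *\<^sub>R (c *\<^sub>C (x::'a::complex_inner))"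
  by (simp add: scaleR_scaleC scaleC_scaleC mult.commute)

lemma bounded_clinear_compose:
  assumes "bounded_clinear f" "bounded_clinear g"
  shows "bounded_clinear (\<lambda>x. f (g x))"
  using assms unfolding bounded_clinear_def by (auto intro: bounded_linear_compose)

lemma bounded_clinear_plus:
  assumes "bounded_clinear f" "bounded_clinear g"
  shows "bounded_clinear (\<lambda>x. f x + g x)"
  using assms unfolding bounded_clinear_def by (auto intro: bounded_linear_add simp: scaleC_add_right)

lemma bounded_clinear_minus:
  assumes "bounded_clinear f" "bounded_clinear g"
  shows "bounded_clinear (\<lambda>x. f x - g x)"
  using assms unfolding bounded_clinear_def by (auto intro: bounded_linear_sub simp: scaleC_diff_right)

lemma bounded_clinear_scaleR_right:
  assumes "bounded_clinear f"
  shows "bounded_clinear (\<lambda>x. r *\<^sub>R f x)"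
  using assms unfolding bounded_clinear_def
  by (auto intro: bounded_linear_compose[OF bounded_linear_scaleR_right] simp: scaleC_scaleR)

lemma contraction_bounded_clinear: "contraction f \<Longrightarrow> bounded_clinear f"
  by (simp add: contraction_def)

lemma contractionI:
  fixes f :: "'a::complex_inner \<Rightarrow> 'b::complex_inner"
  assumes "\<And>x y. f (x + y) = f x + f y" "\<And>c x. f (c *\<^sub>C x) = c *\<^sub>C f x"
    and "\<And>x. norm (f x) \<le> norm x"
  shows "contraction f"
  unfolding contraction_def using bounded_clinearI[of f 1] assms by auto

text \<open>Multiplying the first argument by \<open>\<i>\<close> exposes the imaginary part of the
  form, so identities for complex-linear maps can be tested on the real inner product alone.\<close>

lemma cinner_conv_inner:
  "cinner x y = Complex (inner x y) (- inner (\<i> *\<^sub>C x) y)" for x y :: "'a::complex_inner"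
proof -
  have "inner (\<i> *\<^sub>C x) y = Re (\<i> * cinner x y)"
    by (simp add: Re_cinner[symmetric] cinner_scaleC_left)
  then show ?thesis by (simp add: complex_eq_iff Re_cinner)
qed

lemma inner_scaleC_left: "inner (c *\<^sub>C x) y = inner x (cnj c *\<^sub>C y)" for x y :: "'a::complex_inner"
  by (metis Re_cinner cinner_commute cinner_scaleC_left cnj.simps(1) complex_cnj_cnj complex_cnj_mult)

lemma inner_scaleC_i: "inner (\<i> *\<^sub>C x) x = 0" for x :: "'a::complex_inner"
  using arg_cong[OF cinner_scaleC_left[of \<i> x x], of Re] by (simp add: Re_cinner cinner_self)

lemma bounded_linear_scaleC: "bounded_linear (\<lambda>x::'a::complex_inner. c *\<^sub>C x)"
  by (rule bounded_linear_intro[where K = "cmod c"])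
    (auto simp: scaleC_add_right scaleC_scaleR norm_scaleC mult.commute)

lemma inner_eqI: "(\<And>z. inner x z = inner y z) \<Longrightarrow> x = y"
  for x y :: "'a::real_inner"
  by (metis inner_diff_left inner_eq_zero_iff right_minus_eq)

text \<open>Minimising \<open>\<parallel>X g\<parallel>\<^sup>2 - 2 \<phi> g\<close> yields at once the Riesz representation theorem
  (\<open>X\<close> the identity) and Douglas' factorisation lemma, without a projection onto the closure of
  the range of \<open>X\<close>.\<close>

lemma riesz_range:
  fixes X :: "'a::real_vector \<Rightarrow> 'b::{real_inner, complete_space}" and \<phi> :: "'a \<Rightarrow> real"
  assumes X: "linear X" and \<phi>: "linear \<phi>" and C: "0 \<le> C" "\<And>g. \<bar>\<phi> g\<bar> \<le> C * norm (X g)"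
  shows "\<exists>z \<in> closure (range X). (\<forall>g. \<phi> g = inner (X g) z) \<and> norm z \<le> C"
proof -
  define J where "J g = (norm (X g))\<^sup>2 - 2 * \<phi> g" for g
  have J_ge: "- C\<^sup>2 \<le> J g" for g
  proof -
    have "J g \<ge> (norm (X g))\<^sup>2 - 2 * (C * norm (X g))"
      using C(2)[of g] unfolding J_def by linarith
    moreover have "(norm (X g))\<^sup>2 - 2 * (C * norm (X g)) + C\<^sup>2 = (norm (X g) - C)\<^sup>2"
      by (simp add: power2_diff)
    ultimately show ?thesis using zero_le_power2[of "norm (X g) - C"] by linarith
  qed
  define m where "m = Inf (range J)"
  have bdd: "bdd_below (range J)" using J_ge by (auto intro!: bdd_belowI)
  have m: "m \<le> J g" for g unfolding m_def by (rule cInf_lower[OF _ bdd]) simp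
  have "\<exists>g. J g < m + 1 / Suc n" for n
  proof -
    have "Inf (range J) < m + 1 / Suc n" by (simp add: m_def)
    then show ?thesis using cInf_lessD[of "range J"] by auto
  qed
  then obtain g where g: "\<And>n. J (g n) < m + 1 / Suc n" by metis
  \<comment> \<open>Parallelogram identity, with \<open>m\<close> as lower bound for
    \<open>J\<close> at the midpoint. It makes \<open>X (g n)\<close> a Cauchy sequence although
    \<open>g n\<close> itself need not converge.\<close>
  have par: "(norm (X a - X b))\<^sup>2 \<le> 2 * J a + 2 * J b - 4 * m" for a b
  proof -
    have "J ((1/2) *\<^sub>R (a + b)) = (norm ((1/2) *\<^sub>R (X a + X b)))\<^sup>2 - (\<phi> a + \<phi> b)"
      unfolding J_def
      by (simp only: linear_scale[OF X] linear_add[OF X] linear_scale[OF \<phi>] linear_add[OF \<phi>])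
        (simp add: add_divide_distrib)
    moreover have "(norm ((1/2) *\<^sub>R (X a + X b)))\<^sup>2 = (norm (X a + X b))\<^sup>2 / 4"
      by (simp only: norm_scaleR power_mult_distrib) (simp add: power2_eq_square)
    moreover have "(norm (X a + X b))\<^sup>2 + (norm (X a - X b))\<^sup>2 = 2 * (norm (X a))\<^sup>2 + 2 * (norm (X b))\<^sup>2"
      by (simp add: power2_norm_eq_inner inner_simps inner_commute)
    ultimately have J4: "4 * J ((1/2) *\<^sub>R (a + b))
        = 2 * (norm (X a))\<^sup>2 + 2 * (norm (X b))\<^sup>2 - (norm (X a - X b))\<^sup>2 - 4 * \<phi> a - 4 * \<phi> b"
      by (simp add: field_simps)
    have "4 * m \<le> 4 * J ((1/2) *\<^sub>R (a + b))"
      using m[of "(1/2) *\<^sub>R (a + b)"] by simp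
    then show ?thesis unfolding J4 unfolding J_def by (simp add: algebra_simps)
  qed
  have inv: "(\<lambda>n. 1 / real (Suc n)) \<longlonglongrightarrow> 0"
    using LIMSEQ_inverse_real_of_nat by (simp add: inverse_eq_divide)
  have "Cauchy (\<lambda>n. X (g n))"
  proof (rule metric_CauchyI)
    fix e :: real assume e: "0 < e"
    then have "\<forall>\<^sub>F n in sequentially. 1 / real (Suc n) < e\<^sup>2 / 4"
      by (intro order_tendstoD(2)[OF inv]) simp
    then obtain M where M: "\<And>n. n \<ge> M \<Longrightarrow> 1 / real (Suc n) < e\<^sup>2 / 4"
      by (auto simp: eventually_sequentially)
    show "\<exists>M. \<forall>a\<ge>M. \<forall>b\<ge>M. dist (X (g a)) (X (g b)) < e"
    proof (intro exI allI impI)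
      fix a b assume "M \<le> a" "M \<le> b"
      have "J (g k) < m + e\<^sup>2 / 4" if "M \<le> k" for k
        using g[of k] add_strict_left_mono[OF M[OF that], of m] by (rule order.strict_trans)
      from this[OF \<open>M \<le> a\<close>] this[OF \<open>M \<le> b\<close>]
      have "(dist (X (g a)) (X (g b)))\<^sup>2 < e\<^sup>2"
        unfolding dist_norm by (intro order.strict_trans1[OF par[of "g a" "g b"]]) linarith
      then show "dist (X (g a)) (X (g b)) < e"
        using e power_less_imp_less_base by fastforce
    qed
  qed
  then obtain z where z: "(\<lambda>n. X (g n)) \<longlonglongrightarrow> z"
    using Cauchy_convergent convergent_def by blast
  have Jlim: "(\<lambda>n. J (g n)) \<longlonglongrightarrow> m"
  proof (rule tendsto_sandwich[of "\<lambda>_. m" _ _ "\<lambda>n. m + 1 / real (Suc n)"])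
    show "(\<lambda>n. m + 1 / real (Suc n)) \<longlonglongrightarrow> m" using tendsto_add[OF tendsto_const inv, of m] by simp
  qed (use m g in \<open>auto intro: always_eventually less_imp_le\<close>)
  \<comment> \<open>First variation: compare \<open>m\<close> with \<open>J\<close> at
    \<open>g n + t *\<^sub>R h\<close> and let \<open>n\<close> tend to infinity.\<close>
  have quad: "0 \<le> 2 * t * (inner (X h) z - \<phi> h) + t\<^sup>2 * (norm (X h))\<^sup>2" for t h
  proof -
    have "0 \<le> J (g n) - m + (2 * t * (inner (X h) (X (g n)) - \<phi> h) + t\<^sup>2 * (norm (X h))\<^sup>2)" for n
    proof -
      have "J (g n + t *\<^sub>R h) = J (g n) + (2 * t * (inner (X h) (X (g n)) - \<phi> h) + t\<^sup>2 * (norm (X h))\<^sup>2)"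
        unfolding J_def power2_norm_eq_inner
        by (simp only: linear_scale[OF X] linear_add[OF X] linear_scale[OF \<phi>] linear_add[OF \<phi>])
          (simp add: inner_simps inner_commute power2_eq_square[of t] algebra_simps)
      then show ?thesis using m[of "g n + t *\<^sub>R h"] by linarith
    qed
    moreover have "(\<lambda>n. J (g n) - m + (2 * t * (inner (X h) (X (g n)) - \<phi> h) + t\<^sup>2 * (norm (X h))\<^sup>2))
        \<longlonglongrightarrow> m - m + (2 * t * (inner (X h) z - \<phi> h) + t\<^sup>2 * (norm (X h))\<^sup>2)"
      by (intro tendsto_intros Jlim z)
    ultimately show ?thesis using LIMSEQ_le_const by fastforce
  qed
  have eq: "\<phi> h = inner (X h) z" for h
  proof (rule ccontr)
    define d q where "d = inner (X h) z - \<phi> h" and "q = (norm (X h))\<^sup>2"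
    assume "\<phi> h \<noteq> inner (X h) z"
    then have d: "d \<noteq> 0" by (simp add: d_def)
    have q: "0 \<le> q" by (simp add: q_def)
    \<comment> \<open>At \<open>t = - d * u\<close> the quadratic in \<open>t\<close> equals
      \<open>d\<^sup>2 * u * (u * q - 2)\<close>. The denominator \<open>q + 1\<close> keeps
      \<open>u * q\<close> below 2 and also covers \<open>q = 0\<close>.\<close>
    define u where "u = 1 / (q + 1)"
    have "0 < u" unfolding u_def using q by (intro divide_pos_pos) simp_all
    moreover have "u * q < 2" unfolding u_def using q by (simp add: divide_less_eq)
    ultimately have neg: "d\<^sup>2 * u * (u * q - 2) < 0"
      using d by (intro mult_pos_neg mult_pos_pos) (simp_all only: zero_less_power2 diff_less_0_iff_less not_False_eq_True)
    have "0 \<le> 2 * (- d * u) * d + (- d * u)\<^sup>2 * q"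
      using quad[of "- d * u" h] by (simp only: d_def q_def)
    also have "\<dots> = d\<^sup>2 * u * (u * q - 2)"
      unfolding power2_eq_square right_diff_distrib by (simp add: ac_simps)
    also note neg
    finally show False by simp
  qed
  \<comment> \<open>Insert \<open>g n\<close> into the bound on \<open>\<phi>\<close>, which by
    \<open>eq\<close> bounds \<open>inner (X (g n)) z\<close>; the limit has one factor
    \<open>norm z\<close> to cancel.\<close>
  have "norm z * norm z \<le> C * norm z"
  proof (rule LIMSEQ_le)
    show "(\<lambda>n. inner (X (g n)) z) \<longlonglongrightarrow> norm z * norm z"
      using tendsto_inner[OF z tendsto_const, of z] by (simp add: dot_square_norm power2_eq_square)
    show "(\<lambda>n. C * norm (X (g n))) \<longlonglongrightarrow> C * norm z" by (intro tendsto_intros z)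
    show "\<exists>N. \<forall>n\<ge>N. inner (X (g n)) z \<le> C * norm (X (g n))"
      using abs_le_D1[OF C(2)] unfolding eq by simp
  qed
  then have "norm z \<le> C" using C(1) by (cases "z = 0") auto
  moreover have "z \<in> closure (range X)"
    unfolding closure_sequential using z by (intro exI[of _ "\<lambda>n. X (g n)"]) simp
  ultimately show ?thesis using eq by (intro bexI[of _ z]) simp_all
qed

section \<open>Adjoints of bounded operators\<close>

lemma ex_adjoint:
  fixes f :: "'a::chilbert_space \<Rightarrow> 'b::complex_inner"
  assumes "bounded_clinear f"
  shows "\<exists>g. \<forall>x y. cinner (f x) y = cinner x (g y)"
proof -
  obtain K where K: "0 < K" "\<And>x. norm (f x) \<le> K * norm x"
    using bounded_clinear_bound[OF assms] by blast
  have "\<exists>z. \<forall>x. inner (f x) y = inner x z" for y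
  proof -
    \<comment> \<open>Riesz representation: \<open>riesz_range\<close> with the identity in the role
      of \<open>X\<close>.\<close>
    have "\<exists>z \<in> closure (range (\<lambda>x::'a. x)). (\<forall>x. inner (f x) y = inner x z) \<and> norm z \<le> K * norm y"
    proof (rule riesz_range)
      show "linear (\<lambda>x. inner (f x) y)"
        using assms by (intro linearI) (simp_all add: bounded_clinear_add bounded_clinear_scaleR inner_simps)
      show "\<bar>inner (f x) y\<bar> \<le> K * norm y * norm x" for x
        using Cauchy_Schwarz_ineq2[of "f x" y] mult_right_mono[OF K(2)[of x] norm_ge_zero[of y]]
        by (simp add: ac_simps)
    qed (use K in \<open>auto intro: linearI\<close>)
    then show ?thesis by blast
  qed
  then obtain g where "\<And>x y. inner (f x) y = inner x (g y)" by metis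
  \<comment> \<open>Complex linearity of \<open>f\<close> carries the real adjoint relation over to
    the imaginary part of the form.\<close>
  then show ?thesis
    by (intro exI[of _ g]) (simp add: cinner_conv_inner bounded_clinear_scaleC[OF assms, symmetric])
qed

lemma cadjoint: "bounded_clinear f \<Longrightarrow> cinner (f x) y = cinner x (cadjoint f y)"
  for f :: "'a::chilbert_space \<Rightarrow> 'b::complex_inner"
  unfolding cadjoint_def using someI_ex[OF ex_adjoint[of f]] by blast

lemma inner_cadjoint: "bounded_clinear f \<Longrightarrow> inner x (cadjoint f y) = inner (f x) y"
  for f :: "'a::chilbert_space \<Rightarrow> 'b::complex_inner"
  by (simp add: cadjoint Re_cinner[symmetric])

lemma inner_cadjoint_left: "bounded_clinear f \<Longrightarrow> inner (cadjoint f y) x = inner y (f x)"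
  for f :: "'a::chilbert_space \<Rightarrow> 'b::complex_inner"
  by (simp add: inner_cadjoint inner_commute)

text \<open>A vector is determined by its real inner products, so this real test identifies the
  value of the Hermitian adjoint.\<close>

lemma cadjointI:
  fixes f :: "'a::chilbert_space \<Rightarrow> 'b::complex_inner"
  assumes "bounded_clinear f" "\<And>x. inner x z = inner (f x) y"
  shows "cadjoint f y = z"
  by (rule inner_eqI) (metis assms inner_cadjoint inner_commute)

lemma norm_cadjoint_le:
  fixes f :: "'a::chilbert_space \<Rightarrow> 'b::complex_inner"
  assumes "bounded_clinear f" and K: "\<And>x. norm (f x) \<le> K * norm x" "0 \<le> K"
  shows "norm (cadjoint f y) \<le> K * norm y"
proof -
  have "norm (cadjoint f y) * norm (cadjoint f y) = inner (f (cadjoint f y)) y"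
    using inner_cadjoint[OF assms(1), of "cadjoint f y" y]
    by (simp add: dot_square_norm power2_eq_square)
  also have "\<dots> \<le> K * norm (cadjoint f y) * norm y"
    using norm_cauchy_schwarz[of "f (cadjoint f y)" y]
      mult_right_mono[OF K(1)[of "cadjoint f y"] norm_ge_zero[of y]]
    by linarith
  finally have "norm (cadjoint f y) * norm (cadjoint f y) \<le> (K * norm y) * norm (cadjoint f y)"
    by (simp add: ac_simps)
  then show ?thesis using K(2) by (cases "cadjoint f y = 0") auto
qed

lemma bounded_clinear_cadjoint:
  fixes f :: "'a::chilbert_space \<Rightarrow> 'b::complex_inner"
  assumes f: "bounded_clinear f"
  shows "bounded_clinear (cadjoint f)"
proof -
  obtain K where K: "0 < K" "\<And>x. norm (f x) \<le> K * norm x"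
    using bounded_clinear_bound[OF f] by blast
  show ?thesis
  proof (rule bounded_clinearI[where K = K])
    show "cadjoint f (x + y) = cadjoint f x + cadjoint f y" for x y
      by (rule cadjointI[OF f]) (simp add: inner_add_right inner_cadjoint[OF f])
    show "cadjoint f (c *\<^sub>C x) = c *\<^sub>C cadjoint f x" for c x
    proof (rule cadjointI[OF f])
      fix z
      have "inner z (c *\<^sub>C cadjoint f x) = inner (cnj c *\<^sub>C z) (cadjoint f x)"
        by (simp add: inner_scaleC_left)
      also have "\<dots> = inner (f z) (c *\<^sub>C x)"
        by (simp add: inner_cadjoint[OF f] bounded_clinear_scaleC[OF f] inner_scaleC_left)
      finally show "inner z (c *\<^sub>C cadjoint f x) = inner (f z) (c *\<^sub>C x)" .
    qed
  qed (use norm_cadjoint_le[OF f K(2)] K(1) in auto)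
qed

lemma cadjoint_compose:
  fixes f :: "'a::chilbert_space \<Rightarrow> 'b::chilbert_space" and g :: "'b \<Rightarrow> 'c::complex_inner"
  assumes "bounded_clinear f" "bounded_clinear g"
  shows "cadjoint (\<lambda>x. g (f x)) y = cadjoint f (cadjoint g y)"
  by (rule cadjointI) (simp_all add: assms bounded_clinear_compose inner_cadjoint)

section \<open>Factorisation of one operator through another\<close>

lemma closure_rangeE:
  fixes X :: "'a \<Rightarrow> 'b::first_countable_topology"
  assumes "z \<in> closure (range X)"
  obtains g where "(\<lambda>n. X (g n)) \<longlonglongrightarrow> z"
proof -
  obtain x where x: "\<forall>n. x n \<in> range X" "x \<longlonglongrightarrow> z"
    using assms by (elim closure_sequential[THEN iffD1, THEN exE] conjE)
  from x(1) have "\<forall>n. \<exists>a. x n = X a" by auto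
  then obtain g where "\<forall>n. x n = X (g n)" by (rule choice[THEN exE])
  then have "x = (\<lambda>n. X (g n))" by auto
  then show thesis using x(2) that[of g] by simp
qed

lemma closure_rangeI:
  fixes X :: "'a \<Rightarrow> 'b::first_countable_topology"
  assumes "(\<lambda>n. X (g n)) \<longlonglongrightarrow> z"
  shows "z \<in> closure (range X)"
  unfolding closure_sequential using assms by (intro exI[of _ "\<lambda>n. X (g n)"]) simp

text \<open>The factor is obtained as an adjoint: \<open>Z y\<close> is the vector in the closure of
  the range of \<open>X\<close> that represents the functional \<open>inner (Y g) y\<close> of
  \<open>g\<close>, and \<open>cadjoint Z\<close> then sends \<open>X g\<close> to
  \<open>Y g\<close>.\<close>

lemma douglas_factorization:
  fixes X :: "'g::complex_inner \<Rightarrow> 'k::chilbert_space" and Y :: "'g \<Rightarrow> 'l::chilbert_space"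
  assumes X: "bounded_clinear X" and Y: "bounded_clinear Y"
    and le: "\<And>g. norm (Y g) \<le> norm (X g)"
  shows "\<exists>W. contraction W \<and> (\<forall>g. W (X g) = Y g)"
proof -
  have "\<exists>z\<in>closure (range X). (\<forall>g. inner (Y g) y = inner (X g) z) \<and> norm z \<le> norm y" for y
  proof (rule riesz_range[OF bounded_clinear_linear[OF X]])
    show "linear (\<lambda>g. inner (Y g) y)"
      using Y by (intro linearI) (simp_all add: bounded_clinear_add bounded_clinear_scaleR inner_simps)
    show "\<bar>inner (Y g) y\<bar> \<le> norm y * norm (X g)" for g
      using Cauchy_Schwarz_ineq2[of "Y g" y] mult_right_mono[OF le[of g] norm_ge_zero[of y]]
      by (simp add: ac_simps)
  qed simp
  then obtain Z where Z: "\<And>y. Z y \<in> closure (range X)"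
      "\<And>y g. inner (Y g) y = inner (X g) (Z y)" "\<And>y. norm (Z y) \<le> norm y"
    by metis
  have perp: "z = 0" if "z \<in> closure (range X)" "\<And>g. inner (X g) z = 0" for z
  proof -
    obtain g where g: "(\<lambda>n. X (g n)) \<longlonglongrightarrow> z"
      using \<open>z \<in> closure (range X)\<close> by (rule closure_rangeE)
    have "(\<lambda>n. inner (X (g n)) z) \<longlonglongrightarrow> inner z z" by (intro tendsto_intros g)
    then have "inner z z = 0" using that(2) by (simp add: LIMSEQ_const_iff)
    then show ?thesis by simp
  qed
  have add: "z + z' \<in> closure (range X)" and diff: "z - z' \<in> closure (range X)"
    if z: "z \<in> closure (range X)" "z' \<in> closure (range X)" for z z'
  proof -
    obtain g where g: "(\<lambda>n. X (g n)) \<longlonglongrightarrow> z" using z(1) by (rule closure_rangeE)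
    obtain g' where g': "(\<lambda>n. X (g' n)) \<longlonglongrightarrow> z'" using z(2) by (rule closure_rangeE)
    show "z + z' \<in> closure (range X)"
      using tendsto_add[OF g g'] unfolding bounded_clinear_add[OF X, symmetric]
      by (rule closure_rangeI)
    show "z - z' \<in> closure (range X)"
      using tendsto_diff[OF g g'] unfolding bounded_clinear_diff[OF X, symmetric]
      by (rule closure_rangeI)
  qed
  have scale: "c *\<^sub>C z \<in> closure (range X)" if z: "z \<in> closure (range X)" for c z
  proof -
    obtain g where g: "(\<lambda>n. X (g n)) \<longlonglongrightarrow> z" using z by (rule closure_rangeE)
    show ?thesis
      using bounded_linear.tendsto[OF bounded_linear_scaleC g, of c]
      unfolding bounded_clinear_scaleC[OF X, symmetric]
      by (rule closure_rangeI)
  qed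
  \<comment> \<open>Uniqueness of the representing vector inside the closure; linearity of
    \<open>Z\<close> follows by checking its defining property.\<close>
  have ZI: "Z y = z" if "z \<in> closure (range X)" "\<And>g. inner (Y g) y = inner (X g) z" for y z
    using perp[of "Z y - z"] that Z diff by (simp add: inner_diff_right)
  have "contraction Z"
  proof (rule contractionI)
    show "Z (x + y) = Z x + Z y" for x y
      by (rule ZI) (simp_all add: add Z(1) Z(2)[symmetric] inner_add_right)
    show "Z (c *\<^sub>C x) = c *\<^sub>C Z x" for c x
    proof (rule ZI)
      \<comment> \<open>The functionals are only real-linear; testing with
        \<open>cnj c *\<^sub>C g\<close> moves the complex scalar to the other side.\<close>
      show "inner (Y g) (c *\<^sub>C x) = inner (X g) (c *\<^sub>C Z x)" for g
        using Z(2)[of "cnj c *\<^sub>C g" x]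
        by (simp add: bounded_clinear_scaleC[OF X] bounded_clinear_scaleC[OF Y] inner_scaleC_left)
    qed (simp add: scale Z)
  qed (fact Z(3))
  then have Z': "bounded_clinear Z" by (rule contraction_bounded_clinear)
  have "contraction (cadjoint Z)"
    using norm_cadjoint_le[OF Z', of 1] Z(3) bounded_clinear_cadjoint[OF Z']
    by (simp add: contraction_def)
  moreover have "cadjoint Z (X g) = Y g" for g
    by (rule cadjointI[OF Z']) (metis Z(2) inner_commute)
  ultimately show ?thesis by blast
qed

section \<open>Square roots of positive operators\<close>

text \<open>This is \<open>A\<^sup>2 \<le> K A\<close> in weak form; it comes from positivity at the
  single vector \<open>x - (1/K) *\<^sub>R A x\<close>.\<close>

lemma norm_sq_le_positive_form:
  fixes A :: "'a::complex_inner \<Rightarrow> 'a"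
  assumes A: "bounded_clinear A" and sym: "\<And>x y. inner (A x) y = inner x (A y)"
    and pos: "\<And>x. 0 \<le> inner (A x) x" and K: "0 < K" "\<And>x. norm (A x) \<le> K * norm x"
  shows "(norm (A x))\<^sup>2 \<le> K * inner (A x) x"
proof -
  define y where "y = A x"
  have Ayy: "inner (A y) y \<le> K * (norm y)\<^sup>2"
    using norm_cauchy_schwarz[of "A y" y] mult_right_mono[OF K(2)[of y] norm_ge_zero[of y]]
    by (simp add: power2_eq_square ac_simps)
  have "0 \<le> inner (A (x - (1/K) *\<^sub>R y)) (x - (1/K) *\<^sub>R y)" by (rule pos)
  also have "\<dots> = inner (A x) x - 2 / K * (norm y)\<^sup>2 + (1/K)\<^sup>2 * inner (A y) y"
    unfolding bounded_clinear_diff[OF A] bounded_clinear_scaleR[OF A]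
    using sym[of y x]
    unfolding power2_norm_eq_inner
    by (simp add: inner_simps y_def[symmetric] inner_commute power2_eq_square algebra_simps)
  also have "\<dots> \<le> inner (A x) x - 2 / K * (norm y)\<^sup>2 + (1/K)\<^sup>2 * (K * (norm y)\<^sup>2)"
    using Ayy by (simp add: mult_left_mono)
  also have "\<dots> = inner (A x) x - (norm y)\<^sup>2 / K"
    using K(1) by (simp add: field_simps power2_eq_square)
  finally show ?thesis using K(1) by (simp add: y_def field_simps)
qed

lemma bounded_clinear_pointwise_limit:
  fixes f :: "nat \<Rightarrow> 'a::complex_inner \<Rightarrow> 'b::complex_inner"
  assumes f: "\<And>n. bounded_clinear (f n)" and K: "\<And>n x. norm (f n x) \<le> K * norm x"
    and lim: "\<And>x. (\<lambda>n. f n x) \<longlonglongrightarrow> g x"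
  shows "bounded_clinear g" "\<And>x. norm (g x) \<le> K * norm x"
proof -
  show le: "norm (g x) \<le> K * norm x" for x
    using LIMSEQ_le_const2[OF tendsto_norm[OF lim[of x]]] K by blast
  show "bounded_clinear g"
  proof (rule bounded_clinearI[OF _ _ le])
    fix x y c
    have "(\<lambda>n. f n (x + y)) \<longlonglongrightarrow> g x + g y"
      unfolding bounded_clinear_add[OF f] by (intro tendsto_intros lim)
    then show "g (x + y) = g x + g y" using lim LIMSEQ_unique by blast
    from bounded_linear.tendsto[OF bounded_linear_scaleC lim[of x], of c]
    have "(\<lambda>n. f n (c *\<^sub>C x)) \<longlonglongrightarrow> c *\<^sub>C g x"
      unfolding bounded_clinear_scaleC[OF f] .
    then show "g (c *\<^sub>C x) = c *\<^sub>C g x" using lim LIMSEQ_unique by blast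
  qed
qed

text \<open>The iteration \<open>B\<^sub>n\<^sub>+\<^sub>1 = (C + B\<^sub>n\<^sup>2) / 2\<close>, whose limit \<open>B\<close> satisfies \<open>(1 - B)\<^sup>2 = 1 - C\<close>.\<close>

primrec sqrt_iter :: "('a::complex_inner \<Rightarrow> 'a) \<Rightarrow> nat \<Rightarrow> 'a \<Rightarrow> 'a" where
  "sqrt_iter C 0 x = 0"
| "sqrt_iter C (Suc n) x = (1/2) *\<^sub>R (C x + sqrt_iter C n (sqrt_iter C n x))"

text \<open>The iteration of \<open>sqrt_iter\<close> for the scalar \<open>C = 1\<close>. It
  majorises the operator iteration for every contraction \<open>C\<close>, so its convergence forces
  that of the operators.\<close>

primrec sqrt_bound :: "nat \<Rightarrow> real" where
  "sqrt_bound 0 = 0"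
| "sqrt_bound (Suc n) = (1 + (sqrt_bound n)\<^sup>2) / 2"

lemma sqrt_bound_ge_0: "0 \<le> sqrt_bound n"
  by (induction n) auto

lemma sqrt_bound_le_1: "sqrt_bound n \<le> 1"
  by (induction n) (auto simp: power_le_one sqrt_bound_ge_0)

lemma sqrt_bound_convergent: "convergent sqrt_bound"
proof (rule Bseq_mono_convergent)
  show "Bseq sqrt_bound"
    by (rule BseqI'[where K = 1]) (simp add: sqrt_bound_ge_0 sqrt_bound_le_1)
  have "sqrt_bound n \<le> sqrt_bound (Suc n)" for n
    using sum_squares_bound[of 1 "sqrt_bound n"] by simp
  then show "\<forall>m. \<forall>n\<ge>m. sqrt_bound m \<le> sqrt_bound n"
    using lift_Suc_mono_le[of sqrt_bound] by blast
qed

lemma sqrt_iter_bounded_clinear: "bounded_clinear C \<Longrightarrow> bounded_clinear (sqrt_iter C n)"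
proof (induction n)
  case 0
  then show ?case by (intro bounded_clinearI[where K = 0]) (auto simp: scaleC_zero_right)
next
  case (Suc n)
  then have B: "bounded_clinear (sqrt_iter C n)" by blast
  have "sqrt_iter C (Suc n) = (\<lambda>x. (1/2) *\<^sub>R (C x + sqrt_iter C n (sqrt_iter C n x)))"
    by (simp add: fun_eq_iff)
  then show ?case
    by (simp only:)
      (intro bounded_clinear_scaleR_right bounded_clinear_plus bounded_clinear_compose[OF B B] Suc.prems)
qed

lemma sqrt_iter_symmetric:
  assumes "bounded_clinear C" and sym: "\<And>x y. inner (C x) y = inner x (C y)"
  shows "inner (sqrt_iter C n x) y = inner x (sqrt_iter C n y)"
  by (induction n arbitrary: x y) (simp_all add: sym inner_simps)

lemma sqrt_iter_commute:
  assumes "bounded_clinear E" "\<And>x. E (C x) = C (E x)"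
  shows "E (sqrt_iter C n x) = sqrt_iter C n (E x)"
  by (induction n arbitrary: x)
    (simp_all add: assms bounded_clinear_0 bounded_clinear_scaleR bounded_clinear_add)

lemma sqrt_iter_bound:
  assumes "\<And>x. norm (C x) \<le> norm x"
  shows "norm (sqrt_iter C n x) \<le> sqrt_bound n * norm x"
proof (induction n arbitrary: x)
  case (Suc n)
  have "norm (sqrt_iter C n (sqrt_iter C n x)) \<le> sqrt_bound n * (sqrt_bound n * norm x)"
    using Suc[of "sqrt_iter C n x"] mult_left_mono[OF Suc[of x] sqrt_bound_ge_0[of n]] by linarith
  then have "norm (C x + sqrt_iter C n (sqrt_iter C n x)) \<le> norm x + (sqrt_bound n)\<^sup>2 * norm x"
    using norm_triangle_ineq[of "C x" "sqrt_iter C n (sqrt_iter C n x)"] assms[of x]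
    by (simp add: power2_eq_square)
  then show ?case by (simp add: algebra_simps del: scaleR_add_right)
qed simp

text \<open>Successive iterates \<open>S\<close> and \<open>T\<close> commute, so
  \<open>S\<^sup>2 - T\<^sup>2 = (S + T)(S - T)\<close>, and the estimate follows the same
  factorisation of \<open>s\<^sup>2 - t\<^sup>2\<close> for the scalar bounds.\<close>

lemma sqrt_iter_step:
  assumes C: "bounded_clinear C" and le: "\<And>x. norm (C x) \<le> norm x"
  shows "norm (sqrt_iter C (Suc n) x - sqrt_iter C n x) \<le> (sqrt_bound (Suc n) - sqrt_bound n) * norm x"
proof (induction n arbitrary: x)
  case 0
  show ?case using le[of x] by simp
next
  case (Suc n)
  define S T where "S = sqrt_iter C (Suc n)" and "T = sqrt_iter C n"
  define s t where "s = sqrt_bound (Suc n)" and "t = sqrt_bound n"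
  have lin: "bounded_clinear S" "bounded_clinear T"
    by (simp_all only: S_def T_def sqrt_iter_bounded_clinear[OF C])
  have "C (sqrt_iter C k y) = sqrt_iter C k (C y)" for k y
    by (rule sqrt_iter_commute[OF C]) simp
  then have "S (T y) = T (S y)" for y
    unfolding S_def T_def
    by (intro sqrt_iter_commute sqrt_iter_bounded_clinear[OF C]) (simp del: sqrt_iter.simps)
  then have eq: "S (S x) - T (T x) = S (S x - T x) + T (S x - T x)"
    by (simp add: bounded_clinear_diff[OF lin(1)] bounded_clinear_diff[OF lin(2)])
  have st: "0 \<le> s" "0 \<le> t" unfolding s_def t_def by (rule sqrt_bound_ge_0)+
  have IH: "norm (S x - T x) \<le> (s - t) * norm x"
    using Suc unfolding S_def T_def s_def t_def .
  have "norm (S (S x - T x)) \<le> s * ((s - t) * norm x)"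
    using sqrt_iter_bound[of C "Suc n" "S x - T x", OF le] mult_left_mono[OF IH st(1)]
    unfolding S_def[symmetric] s_def[symmetric] by linarith
  moreover have "norm (T (S x - T x)) \<le> t * ((s - t) * norm x)"
    using sqrt_iter_bound[of C n "S x - T x", OF le] mult_left_mono[OF IH st(2)]
    unfolding T_def[symmetric] t_def[symmetric] by linarith
  ultimately have "norm (S (S x) - T (T x)) \<le> s * ((s - t) * norm x) + t * ((s - t) * norm x)"
    unfolding eq using norm_triangle_ineq[of "S (S x - T x)" "T (S x - T x)"] by linarith
  also have "\<dots> = (s\<^sup>2 - t\<^sup>2) * norm x" by (simp add: power2_eq_square algebra_simps)
  finally have *: "norm (S (S x) - T (T x)) \<le> (s\<^sup>2 - t\<^sup>2) * norm x" .
  have eq1: "sqrt_iter C (Suc (Suc n)) x - sqrt_iter C (Suc n) x = (1/2) *\<^sub>R (S (S x) - T (T x))"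
    unfolding S_def T_def by (simp add: algebra_simps)
  have eq2: "sqrt_bound (Suc (Suc n)) - sqrt_bound (Suc n) = (s\<^sup>2 - t\<^sup>2) / 2"
    unfolding s_def t_def by (simp add: field_simps)
  show ?case unfolding eq1 eq2 using * by simp
qed

text \<open>After rescaling, \<open>C = 1 - A / K\<close> is a contraction by
  \<open>norm_sq_le_positive_form\<close>. The limit \<open>B\<close> of the iteration satisfies
  \<open>(1 - B)\<^sup>2 = A / K\<close>, whence \<open>h = sqrt K (1 - B)\<close>.\<close>

lemma positive_square_root:
  fixes A :: "'a::chilbert_space \<Rightarrow> 'a"
  assumes A: "bounded_clinear A" and sym: "\<And>x y. inner (A x) y = inner x (A y)"
    and pos: "\<And>x. 0 \<le> inner (A x) x"
  shows "\<exists>h :: 'a \<Rightarrow> 'a. bounded_clinear h \<and> (\<forall>x. (norm (h x))\<^sup>2 = inner (A x) x)"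
proof -
  obtain K where K: "0 < K" "\<And>x. norm (A x) \<le> K * norm x"
    using bounded_clinear_bound[OF A] by blast
  define C where "C x = x - (1/K) *\<^sub>R A x" for x
  have C: "bounded_clinear C"
    unfolding C_def
    by (intro bounded_clinear_minus bounded_clinear_id bounded_clinear_scaleR_right A)
  have C_le: "norm (C x) \<le> norm x" for x
  proof -
    have "(norm (C x))\<^sup>2 = (norm x)\<^sup>2 - 2 / K * inner (A x) x + (1/K)\<^sup>2 * (norm (A x))\<^sup>2"
      unfolding C_def power2_norm_eq_inner
      by (simp add: inner_simps inner_commute power2_eq_square[of "1 / K"] algebra_simps)
    also have "\<dots> \<le> (norm x)\<^sup>2 - 2 / K * inner (A x) x + (1/K)\<^sup>2 * (K * inner (A x) x)"
      using norm_sq_le_positive_form[OF A sym pos K, of x] by (simp add: mult_left_mono)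
    also have "\<dots> = (norm x)\<^sup>2 - inner (A x) x / K"
      using K(1) by (simp add: field_simps power2_eq_square)
    also have "\<dots> \<le> (norm x)\<^sup>2" using K(1) pos[of x] by simp
    finally show ?thesis by (simp add: power2_le_iff_abs_le)
  qed
  let ?B = "sqrt_iter C"
  have diff: "norm (?B (n + k) x - ?B n x) \<le> (sqrt_bound (n + k) - sqrt_bound n) * norm x" for n k x
  proof (induction k)
    case (Suc k)
    then show ?case
      using sqrt_iter_step[OF C C_le, of "n + k" x]
        norm_triangle_ineq[of "?B (n + Suc k) x - ?B (n + k) x" "?B (n + k) x - ?B n x"]
      by (simp add: algebra_simps del: sqrt_iter.simps sqrt_bound.simps)
  qed simp
  have "convergent (\<lambda>n. ?B n x)" for x
  proof -
    have b: "Cauchy (\<lambda>n. sqrt_bound n * norm x)"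
      by (intro convergent_Cauchy convergent_mult sqrt_bound_convergent convergent_const)
    have le: "dist (?B m x) (?B n x) \<le> dist (sqrt_bound m * norm x) (sqrt_bound n * norm x)" for m n
    proof -
      have *: "dist (?B m x) (?B n x) \<le> dist (sqrt_bound m * norm x) (sqrt_bound n * norm x)"
        if nm: "n \<le> m" for m n
      proof -
        obtain k where k: "m = n + k" using le_Suc_ex[OF nm] by blast
        have "norm (?B m x - ?B n x) \<le> sqrt_bound m * norm x - sqrt_bound n * norm x"
          using diff[of n k x] by (simp only: k left_diff_distrib)
        also have "\<dots> \<le> \<bar>sqrt_bound m * norm x - sqrt_bound n * norm x\<bar>" by (rule abs_ge_self)
        finally show ?thesis by (simp only: dist_norm real_norm_def)
      qed
      show ?thesis using *[of m n] *[of n m] by (cases "n \<le> m") (auto simp: dist_commute)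
    qed
    have "Cauchy (\<lambda>n. ?B n x)"
      unfolding Cauchy_def using b[unfolded Cauchy_def] le by (meson order.strict_trans1)
    then show ?thesis by (rule Cauchy_convergent)
  qed
  then obtain B where B: "\<And>x. (\<lambda>n. ?B n x) \<longlonglongrightarrow> B x"
    unfolding convergent_def by metis
  have bound: "norm (?B n x) \<le> 1 * norm x" for n x
    using sqrt_iter_bound[of C n x, OF C_le] sqrt_bound_le_1[of n]
    by (meson mult_right_mono norm_ge_zero order_trans)
  have B_lin: "bounded_clinear B"
    using bounded_clinear_pointwise_limit(1)[OF sqrt_iter_bounded_clinear[OF C] bound B] .
  have C_sym: "inner (C x) y = inner x (C y)" for x y
    unfolding C_def by (simp add: inner_simps sym)
  have B_sym: "inner (B x) y = inner x (B y)" for x y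
  proof -
    have "(\<lambda>n. inner (?B n x) y) \<longlonglongrightarrow> inner x (B y)"
      unfolding sqrt_iter_symmetric[OF C C_sym] by (intro tendsto_intros B)
    moreover have "(\<lambda>n. inner (?B n x) y) \<longlonglongrightarrow> inner (B x) y" by (intro tendsto_intros B)
    ultimately show ?thesis using LIMSEQ_unique by blast
  qed
  have B_fix: "B x = (1/2) *\<^sub>R (C x + B (B x))" for x
  proof -
    \<comment> \<open>The index occurs twice; the uniform bound on \<open>?B n\<close> allows the
      inner iterate to be replaced by its limit first.\<close>
    have "(\<lambda>n. ?B n (?B n x) - ?B n (B x)) \<longlonglongrightarrow> 0"
    proof (rule Lim_null_comparison)
      show "\<forall>\<^sub>F n in sequentially. norm (?B n (?B n x) - ?B n (B x)) \<le> norm (?B n x - B x)"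
        using bound by (simp add: bounded_clinear_diff[OF sqrt_iter_bounded_clinear[OF C], symmetric])
      show "(\<lambda>n. norm (?B n x - B x)) \<longlonglongrightarrow> 0"
        using B[of x] LIM_zero_iff tendsto_norm_zero by blast
    qed
    from tendsto_add[OF this B[of "B x"]]
    have "(\<lambda>n. ?B n (?B n x)) \<longlonglongrightarrow> B (B x)" by simp
    then have "(\<lambda>n. ?B (Suc n) x) \<longlonglongrightarrow> (1/2) *\<^sub>R (C x + B (B x))"
      unfolding sqrt_iter.simps by (intro tendsto_intros)
    then show ?thesis using LIMSEQ_Suc[OF B[of x]] LIMSEQ_unique by blast
  qed
  define h where "h x = sqrt K *\<^sub>R (x - B x)" for x
  have "(norm (h x))\<^sup>2 = inner (A x) x" for x
  proof -
    have "2 *\<^sub>R B x = C x + B (B x)"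
      using arg_cong[OF B_fix[of x], of "\<lambda>v. 2 *\<^sub>R v"] by simp
    then have eq: "x - 2 *\<^sub>R B x + B (B x) = x - C x" by simp
    have "(norm (h x))\<^sup>2 = K * (norm (x - B x))\<^sup>2"
      using K(1) by (simp add: h_def power_mult_distrib)
    also have "(norm (x - B x))\<^sup>2 = inner (x - 2 *\<^sub>R B x + B (B x)) x"
      by (simp add: power2_norm_eq_inner inner_simps B_sym inner_commute)
    also note eq
    also have "inner (x - C x) x = inner (A x) x / K"
      by (simp add: C_def)
    finally show ?thesis using K(1) by simp
  qed
  moreover have "bounded_clinear h"
    unfolding h_def by (intro bounded_clinear_scaleR_right bounded_clinear_minus bounded_clinear_id B_lin)
  ultimately show ?thesis by (intro exI[of _ h]) simp
qed

section \<open>Branches of Fock space vectors\<close>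

lemmas coord_l2_simps [simp] = zero_l2.rep_eq plus_l2.rep_eq minus_l2.rep_eq scaleC_l2.rep_eq
  branch.rep_eq degree_proj.rep_eq

text \<open>For a word \<open>i\<close>, the elementary tensor of the basis vector at
  \<open>i\<close> with \<open>e\<close>.\<close>

lift_definition vec_at :: "'i \<Rightarrow> 'e::real_inner \<Rightarrow> ('i, 'e) l2" is "\<lambda>i e j. if j = i then e else 0"
proof -
  fix i :: 'i and e :: 'e
  show "(\<lambda>j. (norm (if j = i then e else 0))\<^sup>2) summable_on UNIV"
    by (rule finite_nonzero_values_imp_summable_on) (rule finite_subset[of _ "{i}"], auto)
qed

lemma inner_vec_at: "inner f (vec_at i e) = inner (coord f i) e"
  unfolding inner_l2_def
  by (rule infsumI, rule has_sum_finite_neutralI[of "{i}"]) (auto simp: vec_at.rep_eq)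

text \<open>Columns over a finite index set; in a colligation, the states at the children of a
  node.\<close>

lift_definition tuple :: "('i::finite \<Rightarrow> 'e::real_inner) \<Rightarrow> ('i, 'e) l2" is "\<lambda>h. h" by simp

lemma norm_tuple_sq: "(norm (tuple h))\<^sup>2 = (\<Sum>i\<in>UNIV. (norm (h i))\<^sup>2)"
  by (simp add: norm_l2_sq tuple.rep_eq)

lemma tuple_add: "tuple (\<lambda>i. h i + h' i) = tuple h + tuple h'"
  and tuple_diff: "tuple (\<lambda>i. h i - h' i) = tuple h - tuple h'"
  by (rule l2_eqI; simp add: tuple.rep_eq)+

lemma tuple_scaleC: "tuple (\<lambda>i. c *\<^sub>C h i) = c *\<^sub>C tuple h"
  by (rule l2_eqI) (simp add: tuple.rep_eq)

text \<open>Inverse of the splitting of a vector into its coefficient at the empty word and its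
  branches.\<close>

definition node :: "'e \<Rightarrow> ('n::finite \<Rightarrow> ('n, 'e) fock) \<Rightarrow> ('n, 'e::real_inner) fock" where
  "node e h = vec_at [] e + join h"

lemma coord_node [simp]: "coord (node e h) [] = e"
  by (simp add: node_def vec_at.rep_eq join.rep_eq)

lemma branch_node [simp]: "branch k (node e h) = h k"
  by (rule l2_eqI) (simp add: node_def vec_at.rep_eq join.rep_eq)

lemma fock_eqI: "coord f [] = coord g [] \<Longrightarrow> (\<And>k. branch k f = branch k g) \<Longrightarrow> f = g"
  by (rule l2_eqI) (metis branch.rep_eq neq_Nil_conv)

lemma branch_add [simp]: "branch k (f + g) = branch k f + branch k g"
  and branch_diff [simp]: "branch k (f - g) = branch k f - branch k g"
  and branch_0 [simp]: "branch k 0 = 0"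
  by (rule l2_eqI; simp)+

lemma branch_scaleC [simp]: "branch k (c *\<^sub>C f) = c *\<^sub>C branch k f"
  by (rule l2_eqI) simp

lemma UNIV_lists_branches: "UNIV = insert [] (\<Union>k\<in>UNIV. range ((#) k))"
  by (auto simp: image_iff) (metis list.exhaust)

text \<open>A word is empty or has a unique first letter; this splitting drives every induction on
  depth below.\<close>

lemma inner_fock:
  fixes f g :: "('n::finite, 'e::real_inner) fock"
  shows "inner f g = inner (coord f []) (coord g []) + (\<Sum>k\<in>UNIV. inner (branch k f) (branch k g))"
proof -
  let ?p = "\<lambda>\<sigma>. inner (coord f \<sigma>) (coord g \<sigma>)"
  have "(?p has_sum inner (branch k f) (branch k g)) (range ((#) k))" for k
  proof -
    have "((\<lambda>\<sigma>. inner (coord (branch k f) \<sigma>) (coord (branch k g) \<sigma>))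
        has_sum inner (branch k f) (branch k g)) UNIV"
      unfolding inner_l2_def by (rule has_sum_infsum[OF l2_inner_summable])
    then show ?thesis by (simp add: has_sum_reindex o_def)
  qed
  then have "(?p has_sum (\<Sum>k\<in>UNIV. inner (branch k f) (branch k g))) (\<Union>k\<in>UNIV. range ((#) k))"
    by (intro sum_has_sum) auto
  then have "(?p has_sum (inner (coord f []) (coord g []) + (\<Sum>k\<in>UNIV. inner (branch k f) (branch k g)))) UNIV"
    by (subst UNIV_lists_branches) (rule has_sum_insert, auto)
  then show ?thesis unfolding inner_l2_def[of f g] by (rule infsumI)
qed

lemma norm_fock_sq:
  "(norm f)\<^sup>2 = (norm (coord f []))\<^sup>2 + (\<Sum>k\<in>UNIV. (norm (branch k f))\<^sup>2)"
  for f :: "('n::finite, 'e::real_inner) fock"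
  unfolding power2_norm_eq_inner by (rule inner_fock)

lemma branch_degree_proj_0 [simp]: "branch k (degree_proj 0 f) = 0"
  and branch_degree_proj_Suc [simp]: "branch k (degree_proj (Suc i) f) = degree_proj i (branch k f)"
  by (rule l2_eqI; simp)+

lemma degree_proj_zero [simp]: "degree_proj i 0 = 0"
  by (rule l2_eqI) simp

text \<open>\<open>branch k\<close> is the adjoint of the left creation operator of the letter \<open>k\<close>.\<close>

lemma schur_classI:
  fixes T :: "('n::finite, 'e1::complex_inner) fock \<Rightarrow> ('n, 'e2::complex_inner) fock"
  assumes T: "contraction T" and br: "\<And>k f. branch k (T f) = T (branch k f)"
  shows "T \<in> schur_class"
proof -
  have T0: "T 0 = 0" using T by (simp add: contraction_bounded_clinear bounded_clinear_0)
  \<comment> \<open>Passing to a branch lowers both degrees by one. At \<open>j = 0\<close> the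
    branch of the input is already zero.\<close>
  have lower: "entry T i j f = 0" if "j < i" for i j f
    using that
  proof (induction i arbitrary: j f)
    case (Suc i)
    show ?case
    proof (rule fock_eqI)
      fix k show "branch k (entry T (Suc i) j f) = branch k 0"
      proof (cases j)
        case 0
        then show ?thesis by (simp add: entry_def br T0)
      next
        case (Suc j')
        then show ?thesis
          using Suc.IH[of j' "branch k f"] Suc.prems by (simp add: entry_def br)
      qed
    qed (simp add: entry_def)
  qed simp
  \<comment> \<open>Both sides vanish at the empty word, and the \<open>k\<close>-th branch of
    either is \<open>entry T i j (branch k f)\<close>.\<close>
  have toeplitz: "entry T (Suc i) (Suc j) f = ampliation (entry T i j) f" for i j f
  proof (rule fock_eqI)
    show "coord (entry T (Suc i) (Suc j) f) [] = coord (ampliation (entry T i j) f) []"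
      by (simp add: entry_def ampliation_def join.rep_eq)
    have "branch k (join h) = h k" for k and h :: "'n \<Rightarrow> ('n, 'e2) fock"
      by (rule l2_eqI) (simp add: join.rep_eq)
    then show "branch k (entry T (Suc i) (Suc j) f) = branch k (ampliation (entry T i j) f)" for k
      by (simp add: entry_def ampliation_def br)
  qed
  have "entry T i j = ampliation (entry T (i - 1) (j - 1))" if "1 \<le> i" "i \<le> j" for i j
    using that toeplitz[of "i - 1" "j - 1"] by (intro ext) simp
  then show ?thesis using T lower by (auto simp: schur_class_def fun_eq_iff)
qed

section \<open>Sums over words by length, and tails of Fock space vectors\<close>

lemma sum_lists_Cons:
  fixes p :: "'n::finite list \<Rightarrow> 'a::comm_monoid_add"
  shows "sum p ((\<lambda>(k, \<sigma>). k # \<sigma>) ` (UNIV \<times> S)) = (\<Sum>k\<in>UNIV. \<Sum>\<sigma>\<in>S. p (k # \<sigma>))"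
  by (subst sum.reindex) (auto simp: inj_on_def sum.cartesian_product o_def case_prod_unfold)

lemma finite_length_eq: "finite {\<sigma>::'n::finite list. length \<sigma> = d}"
  using finite_lists_length_eq[of "UNIV::'n set" d] by simp

lemma finite_length_less: "finite {\<sigma>::'n::finite list. length \<sigma> < d}"
  by (rule finite_subset[OF _ finite_lists_length_le[of "UNIV::'n set" d]]) auto

lemma sum_length_Suc:
  fixes p :: "'n::finite list \<Rightarrow> 'a::comm_monoid_add"
  shows "(\<Sum>\<sigma> | length \<sigma> = Suc d. p \<sigma>) = (\<Sum>k\<in>UNIV. \<Sum>\<sigma> | length \<sigma> = d. p (k # \<sigma>))"
proof -
  have "{\<sigma>::'n list. length \<sigma> = Suc d} = (\<lambda>(k, \<sigma>). k # \<sigma>) ` (UNIV \<times> {\<sigma>. length \<sigma> = d})"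
    by (auto simp: length_Suc_conv)
  then show ?thesis by (simp add: sum_lists_Cons)
qed

lemma sum_length_less_Suc:
  fixes p :: "'n::finite list \<Rightarrow> 'a::comm_monoid_add"
  shows "(\<Sum>\<sigma> | length \<sigma> < Suc d. p \<sigma>) = p [] + (\<Sum>k\<in>UNIV. \<Sum>\<sigma> | length \<sigma> < d. p (k # \<sigma>))"
proof -
  let ?S = "(\<lambda>(k, \<sigma>). k # \<sigma>) ` (UNIV \<times> {\<sigma>::'n list. length \<sigma> < d})"
  have eq: "{\<sigma>::'n list. length \<sigma> < Suc d} = insert [] ?S"
    by (auto simp: less_Suc_eq_0_disj length_Suc_conv image_iff)
  have "(\<Sum>\<sigma> | length \<sigma> < Suc d. p \<sigma>) = p [] + sum p ?S"
    unfolding eq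
  proof (rule sum.insert)
    show "finite ?S" by (intro finite_imageI finite_cartesian_product finite_length_less finite)
  qed auto
  then show ?thesis unfolding sum_lists_Cons .
qed

text \<open>The squared norm carried by words of length at least \<open>d\<close>, written
  recursively along branches to match inductions on depth.\<close>

primrec tail :: "nat \<Rightarrow> ('n::finite, 'e::real_inner) fock \<Rightarrow> real" where
  "tail 0 f = (norm f)\<^sup>2"
| "tail (Suc d) f = (\<Sum>k\<in>UNIV. tail d (branch k f))"

lemma tail_nonneg: "0 \<le> tail d f"
  by (induction d arbitrary: f) (auto intro: sum_nonneg)

lemma norm_sq_eq_tail: "(norm f)\<^sup>2 = (\<Sum>\<sigma> | length \<sigma> < d. (norm (coord f \<sigma>))\<^sup>2) + tail d f"
proof (induction d arbitrary: f)
  case (Suc d)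
  have "(norm f)\<^sup>2 = (norm (coord f []))\<^sup>2 + (\<Sum>k\<in>UNIV. (norm (branch k f))\<^sup>2)"
    by (rule norm_fock_sq)
  also have "(\<Sum>k\<in>UNIV. (norm (branch k f))\<^sup>2)
      = (\<Sum>k\<in>UNIV. \<Sum>\<sigma> | length \<sigma> < d. (norm (coord f (k # \<sigma>)))\<^sup>2) + tail (Suc d) f"
    by (subst Suc) (simp add: sum.distrib)
  finally show ?case by (simp only: sum_length_less_Suc add.assoc)
qed simp

lemma tail_tendsto_0: "(\<lambda>d. tail d f) \<longlonglongrightarrow> 0"
proof (rule LIMSEQ_I)
  fix r :: real assume r: "0 < r"
  let ?p = "\<lambda>\<sigma>. (norm (coord f \<sigma>))\<^sup>2"
  have "(?p has_sum (norm f)\<^sup>2) UNIV"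
    unfolding norm_l2_sq by (rule has_sum_infsum[OF l2_summable])
  then obtain S where S: "finite S" "dist (sum ?p S) ((norm f)\<^sup>2) \<le> r / 2"
    using has_sum_finite_approximation[of ?p UNIV "(norm f)\<^sup>2" "r / 2"] r by auto
  \<comment> \<open>A finite set of words has bounded length, so the words shorter than
    \<open>D\<close> contain the approximating set.\<close>
  obtain D where D: "\<forall>\<sigma>\<in>S. length \<sigma> < D"
    using finite_nat_set_iff_bounded[of "length ` S"] S(1) by auto
  have "norm (tail d f - 0) < r" if "D \<le> d" for d
  proof -
    have "sum ?p S \<le> (\<Sum>\<sigma> | length \<sigma> < d. ?p \<sigma>)"
      using D that by (intro sum_mono2 finite_length_less) auto
    moreover have "(norm f)\<^sup>2 - sum ?p S \<le> r / 2"
      using S(2) abs_ge_minus_self[of "sum ?p S - (norm f)\<^sup>2"] unfolding dist_real_def by linarith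
    ultimately show ?thesis using norm_sq_eq_tail[of f d] tail_nonneg[of d f] r by simp
  qed
  then show "\<exists>D. \<forall>d\<ge>D. norm (tail d f - 0) < r" by blast
qed

section \<open>Transfer operators of contractive colligations\<close>

text \<open>\<open>W\<close> is the block matrix of a system running backwards along the tree of words: the
  states at the children \<open>\<sigma>k\<close> of a node \<open>\<sigma>\<close> and the input at \<open>\<sigma>\<close> determine the state and the output
  at \<open>\<sigma>\<close>.  \<open>transfer W m\<close> is the input-output map when the states at depth \<open>m\<close> are set to zero.\<close>

primrec state :: "(('n::finite, 'h::complex_inner) l2 \<times> 'e1::complex_inner
    \<Rightarrow> 'h \<times> 'e2::complex_inner) \<Rightarrow> nat \<Rightarrow> ('n, 'e1) fock \<Rightarrow> 'h" where
  "state W 0 f = 0"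
| "state W (Suc m) f = fst (W (tuple (\<lambda>k. state W m (branch k f)), coord f []))"

primrec transfer :: "(('n::finite, 'h::complex_inner) l2 \<times> 'e1::complex_inner
    \<Rightarrow> 'h \<times> 'e2::complex_inner) \<Rightarrow> nat \<Rightarrow> ('n, 'e1) fock \<Rightarrow> ('n, 'e2) fock" where
  "transfer W 0 f = 0"
| "transfer W (Suc m) f = node (snd (W (tuple (\<lambda>k. state W m (branch k f)), coord f [])))
    (\<lambda>k. transfer W m (branch k f))"

lemma norm_prod_sq: "(norm p)\<^sup>2 = (norm (fst p))\<^sup>2 + (norm (snd p))\<^sup>2"
  by (simp add: norm_prod_def)

lemma node_add: "node (e + e') (\<lambda>k. h k + h' k) = node e h + node e' h'"
  and node_diff: "node (e - e') (\<lambda>k. h k - h' k) = node e h - node e' h'"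
  by (rule fock_eqI; simp)+

lemma node_scaleC: "node (c *\<^sub>C e) (\<lambda>k. c *\<^sub>C h k) = c *\<^sub>C node e h"
  by (rule fock_eqI; simp)

lemma state_add: "bounded_clinear W \<Longrightarrow> state W m (f + g) = state W m f + state W m g"
proof (induction m arbitrary: f g)
  case (Suc m)
  then show ?case
    using bounded_clinear_add[OF Suc.prems,
        of "(tuple (\<lambda>k. state W m (branch k f)), coord f [])"
          "(tuple (\<lambda>k. state W m (branch k g)), coord g [])"]
    by (simp add: tuple_add)
qed simp

lemma state_scaleC: "bounded_clinear W \<Longrightarrow> state W m (c *\<^sub>C f) = c *\<^sub>C state W m f"
proof (induction m arbitrary: f)
  case (Suc m)
  then show ?case
    using bounded_clinear_scaleC[OF Suc.prems,
        of c "(tuple (\<lambda>k. state W m (branch k f)), coord f [])"]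
    by (simp add: tuple_scaleC scaleC_prod_def)
qed (simp add: scaleC_zero_right)

lemma transfer_add: "bounded_clinear W \<Longrightarrow> transfer W m (f + g) = transfer W m f + transfer W m g"
proof (induction m arbitrary: f g)
  case (Suc m)
  then show ?case
    using bounded_clinear_add[OF Suc.prems,
        of "(tuple (\<lambda>k. state W m (branch k f)), coord f [])"
          "(tuple (\<lambda>k. state W m (branch k g)), coord g [])"]
    by (simp add: tuple_add state_add node_add)
qed simp

lemma transfer_scaleC: "bounded_clinear W \<Longrightarrow> transfer W m (c *\<^sub>C f) = c *\<^sub>C transfer W m f"
proof (induction m arbitrary: f)
  case (Suc m)
  then show ?case
    using bounded_clinear_scaleC[OF Suc.prems,
        of c "(tuple (\<lambda>k. state W m (branch k f)), coord f [])"]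
    by (simp add: tuple_scaleC scaleC_prod_def state_scaleC node_scaleC)
qed (simp add: scaleC_zero_right)

text \<open>Energy balance at one node: contractivity of \<open>W\<close> bounds the outgoing state
  \<open>x\<close> and output \<open>y\<close>, and the energy of the outputs \<open>t\<close> on
  the subtrees is added to both sides.\<close>

lemma colligation_step:
  fixes W :: "('n::finite, 'h::complex_inner) l2 \<times> 'e1::complex_inner \<Rightarrow> 'h \<times> 'e2::complex_inner"
  assumes "contraction W" and xy: "W (tuple h, e) = (x, y)"
  shows "(norm (node y t))\<^sup>2 + (norm x)\<^sup>2
    \<le> (norm e)\<^sup>2 + (\<Sum>k\<in>UNIV. (norm (t k))\<^sup>2 + (norm (h k))\<^sup>2)"
proof -
  have "norm (x, y) \<le> norm (tuple h, e)"
    using assms unfolding contraction_def by metis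
  then have "(norm (x, y))\<^sup>2 \<le> (norm (tuple h, e))\<^sup>2" by (rule power_mono) simp
  then show ?thesis
    by (simp add: norm_prod_sq norm_tuple_sq norm_fock_sq[of "node y t"] sum.distrib)
qed

text \<open>Summing the balance over the tree, the states of the children are paid for by the inputs
  on their subtrees.\<close>

lemma transfer_state_norm:
  assumes "contraction W"
  shows "(norm (transfer W m f))\<^sup>2 + (norm (state W m f))\<^sup>2 \<le> (norm f)\<^sup>2"
proof (induction m arbitrary: f)
  case (Suc m)
  have "(norm (transfer W (Suc m) f))\<^sup>2 + (norm (state W (Suc m) f))\<^sup>2
    \<le> (norm (coord f []))\<^sup>2
      + (\<Sum>k\<in>UNIV. (norm (transfer W m (branch k f)))\<^sup>2 + (norm (state W m (branch k f)))\<^sup>2)"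
    unfolding transfer.simps state.simps by (rule colligation_step[OF assms]) simp
  also have "\<dots> \<le> (norm (coord f []))\<^sup>2 + (\<Sum>k\<in>UNIV. (norm (branch k f))\<^sup>2)"
    by (intro add_left_mono sum_mono Suc)
  finally show ?case unfolding norm_fock_sq[of f] .
qed simp

lemma norm_diff_sq_le: "(norm (x - y))\<^sup>2 \<le> 2 * (norm x)\<^sup>2 + 2 * (norm y)\<^sup>2"
  for x y :: "'a::real_inner"
proof -
  have "(norm (x - y))\<^sup>2 + (norm (x + y))\<^sup>2 = 2 * (norm x)\<^sup>2 + 2 * (norm y)\<^sup>2"
    by (simp add: power2_norm_eq_inner inner_simps inner_commute)
  then show ?thesis using zero_le_power2[of "norm (x + y)"] by linarith
qed

text \<open>The difference of two truncations obeys the same recursion with zero input down to depth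
  \<open>d\<close>. There the crude bound on each gives \<open>2 + 2\<close> times the remaining
  energy.\<close>

lemma transfer_state_diff:
  fixes W :: "('n::finite, 'h::complex_inner) l2 \<times> 'e1::complex_inner \<Rightarrow> 'h \<times> 'e2::complex_inner"
  assumes W: "contraction W"
  shows "d \<le> m \<Longrightarrow> d \<le> m' \<Longrightarrow>
    (norm (transfer W m f - transfer W m' f))\<^sup>2 + (norm (state W m f - state W m' f))\<^sup>2 \<le> 4 * tail d f"
proof (induction d arbitrary: m m' f)
  case 0
  show ?case
    using norm_diff_sq_le[of "transfer W m f" "transfer W m' f"]
      norm_diff_sq_le[of "state W m f" "state W m' f"]
      transfer_state_norm[OF W, of m f] transfer_state_norm[OF W, of m' f]
    by simp
next
  case (Suc d)
  obtain n n' where n: "m = Suc n" "m' = Suc n'" "d \<le> n" "d \<le> n'"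
    using Suc.prems by (metis Suc_le_D Suc_le_mono)
  let ?v = "\<lambda>m. (tuple (\<lambda>k. state W m (branch k f)), coord f [])"
  have v: "?v n - ?v n' = (tuple (\<lambda>k. state W n (branch k f) - state W n' (branch k f)), 0)"
    by (simp add: tuple_diff)
  have "(norm (transfer W m f - transfer W m' f))\<^sup>2 + (norm (state W m f - state W m' f))\<^sup>2
    \<le> (norm (0::'e1))\<^sup>2 + (\<Sum>k\<in>UNIV.
        (norm (transfer W n (branch k f) - transfer W n' (branch k f)))\<^sup>2
        + (norm (state W n (branch k f) - state W n' (branch k f)))\<^sup>2)"
    unfolding n transfer.simps state.simps node_diff[symmetric]
  proof (rule colligation_step[OF W])
    show "W (tuple (\<lambda>k. state W n (branch k f) - state W n' (branch k f)), 0) =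
        (fst (W (?v n)) - fst (W (?v n')), snd (W (?v n)) - snd (W (?v n')))"
      unfolding v[symmetric] bounded_clinear_diff[OF contraction_bounded_clinear[OF W]]
      by (simp add: prod_eq_iff)
  qed
  also have "\<dots> \<le> (norm (0::'e1))\<^sup>2 + (\<Sum>k\<in>UNIV. 4 * tail d (branch k f))"
    by (intro add_left_mono sum_mono Suc.IH n)
  finally show ?case by (simp add: sum_distrib_left)
qed

lemma norm_branch_le: "norm (branch k f) \<le> norm f"
  for f :: "('n::finite, 'e::real_inner) fock"
proof -
  have "(norm (branch k f))\<^sup>2 \<le> (\<Sum>k\<in>UNIV. (norm (branch k f))\<^sup>2)"
    by (rule member_le_sum) auto
  also have "\<dots> \<le> (norm f)\<^sup>2" by (simp add: norm_fock_sq[of f])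
  finally show ?thesis by (simp add: power2_le_iff_abs_le)
qed

lemma bounded_clinear_branch:
  "bounded_clinear (branch k :: ('n::finite, 'e::complex_inner) fock \<Rightarrow> ('n, 'e) fock)"
  by (rule bounded_clinearI[where K = 1]) (simp_all add: norm_branch_le)

lemma ex_transfer_limit:
  fixes W :: "('n::finite, 'h::complex_inner) l2 \<times> 'e1::complex_inner \<Rightarrow> 'h \<times> 'e2::chilbert_space"
  assumes W: "contraction W"
  shows "\<exists>T\<in>schur_class. \<forall>f. (\<lambda>m. transfer W m f) \<longlonglongrightarrow> T f"
proof -
  have "convergent (\<lambda>m. transfer W m f)" for f
  proof (rule Cauchy_convergent, rule metric_CauchyI)
    fix r :: real assume r: "0 < r"
    have "(\<lambda>d. 4 * tail d f) \<longlonglongrightarrow> 4 * 0" by (intro tendsto_intros tail_tendsto_0)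
    then have "\<forall>\<^sub>F d in sequentially. 4 * tail d f < r\<^sup>2"
      by (rule order_tendstoD(2)) (use r in simp)
    then obtain d where d: "4 * tail d f < r\<^sup>2"
      by (auto simp: eventually_sequentially)
    show "\<exists>M. \<forall>m\<ge>M. \<forall>n\<ge>M. dist (transfer W m f) (transfer W n f) < r"
    proof (intro exI allI impI)
      fix m n assume mn: "d \<le> m" "d \<le> n"
      have "(dist (transfer W m f) (transfer W n f))\<^sup>2 < r\<^sup>2"
        unfolding dist_norm
        using transfer_state_diff[OF W mn, of f] d zero_le_power2[of "norm (state W m f - state W n f)"]
        by linarith
      then show "dist (transfer W m f) (transfer W n f) < r"
        by (rule power_less_imp_less_base) (use r in simp)
    qed
  qed
  then have "\<forall>f. \<exists>l. (\<lambda>m. transfer W m f) \<longlonglongrightarrow> l" unfolding convergent_def by blast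
  then obtain T where T: "\<forall>f. (\<lambda>m. transfer W m f) \<longlonglongrightarrow> T f" by (rule choice[THEN exE])
  have bound: "norm (transfer W m f) \<le> 1 * norm f" for m f
  proof -
    have "(norm (transfer W m f))\<^sup>2 \<le> (norm f)\<^sup>2"
      using transfer_state_norm[OF W, of m f] zero_le_power2[of "norm (state W m f)"] by linarith
    then show ?thesis by (simp add: power2_le_iff_abs_le)
  qed
  have lin: "bounded_clinear (transfer W m)" for m
    using W by (intro bounded_clinearI[OF _ _ bound])
      (simp_all add: contraction_bounded_clinear transfer_add transfer_scaleC)
  have "contraction T"
    using bounded_clinear_pointwise_limit[OF lin bound T[rule_format]] by (simp add: contraction_def)
  \<comment> \<open>A truncation loses one level when it passes to a branch; in the limit this shift
    of the index is harmless.\<close>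
  moreover have "branch k (T f) = T (branch k f)" for k f
  proof -
    have "bounded_linear (branch k :: ('n, 'e2) fock \<Rightarrow> _)"
      using bounded_clinear_branch unfolding bounded_clinear_def by blast
    then have "(\<lambda>m. branch k (transfer W (Suc m) f)) \<longlonglongrightarrow> branch k (T f)"
      using LIMSEQ_Suc[OF T[rule_format, of f]] by (rule bounded_linear.tendsto)
    then have "(\<lambda>m. transfer W m (branch k f)) \<longlonglongrightarrow> branch k (T f)" by simp
    then show ?thesis using T[rule_format, of "branch k f"] by (rule LIMSEQ_unique)
  qed
  ultimately show ?thesis using T by (intro bexI[of _ T] schur_classI)
qed

section \<open>Wave operators and the displacement equation\<close>

lemma contraction_word_op: "(\<And>k. contraction (F k)) \<Longrightarrow> contraction (word_op F \<sigma>)"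
proof (induction \<sigma>)
  case Nil
  then show ?case by (simp add: contraction_def id_def bounded_clinear_id)
next
  case (Cons k \<sigma>)
  have F: "contraction (F k)" "contraction (word_op F \<sigma>)" using Cons by blast+
  then have "norm (F k (word_op F \<sigma> x)) \<le> norm x" for x
    unfolding contraction_def by (meson order_trans)
  moreover have "bounded_clinear (\<lambda>x. F k (word_op F \<sigma> x))"
    by (rule bounded_clinear_compose[OF F[THEN contraction_bounded_clinear]])
  ultimately show ?case by (simp add: contraction_def o_def)
qed

lemma cadjoint_word_op_Nil: "cadjoint (word_op F []) g = g"
  for g :: "'g::chilbert_space"
  by (rule cadjointI) (simp_all add: id_def bounded_clinear_id)

text \<open>The adjoint reverses products, so the adjoint of the first letter acts first and
  inductions on words must generalise over \<open>g\<close>.\<close>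

lemma cadjoint_word_op_Cons:
  fixes F :: "'n \<Rightarrow> 'g::chilbert_space \<Rightarrow> 'g"
  assumes "\<And>k. contraction (F k)"
  shows "cadjoint (word_op F (k # \<sigma>)) g = cadjoint (word_op F \<sigma>) (cadjoint (F k) g)"
  using cadjoint_compose[of "word_op F \<sigma>" "F k" g] assms
  by (simp add: o_def contraction_bounded_clinear contraction_word_op)

locale wave =
  fixes F :: "'n::finite \<Rightarrow> 'g::chilbert_space \<Rightarrow> 'g" and U :: "'e::chilbert_space \<Rightarrow> 'g"
    and W :: "'g \<Rightarrow> ('n, 'e) fock"
  assumes F: "\<And>k. contraction (F k)" and U: "bounded_clinear U" and wave: "bounded_wave_operator F U W"
begin

lemma W: "bounded_clinear W"
  using wave by (simp add: bounded_wave_operator_def)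

text \<open>The weak form of
  \<open>coord (W g) \<sigma> = U\<^sup>* F\<^sub>\<sigma>\<^sup>* g\<close>, read off by pairing
  with the elementary tensor at \<open>\<sigma>\<close>.\<close>

lemma inner_coord: "inner (coord (W g) \<sigma>) e = inner g (word_op F \<sigma> (U e))"
proof -
  have lin: "bounded_clinear (word_op F \<tau>)" for \<tau>
    using F by (intro contraction_bounded_clinear contraction_word_op)
  have "inner (coord (W g) \<sigma>) e = inner (W g) (vec_at \<sigma> e)" by (simp add: inner_vec_at)
  also have "\<dots> = inner g (cadjoint W (vec_at \<sigma> e))" by (simp add: inner_cadjoint[OF W])
  also have "vec_at \<sigma> e = degree_proj (length \<sigma>) (vec_at \<sigma> e)"
    by (rule l2_eqI) (simp add: vec_at.rep_eq)
  also have "cadjoint W \<dots> = word_row F U (length \<sigma>) (vec_at \<sigma> e)"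
    using wave by (simp add: bounded_wave_operator_def)
  also have "\<dots> = (\<Sum>\<tau>\<in>{\<sigma>}. word_op F \<tau> (U (coord (vec_at \<sigma> e) \<tau>)))"
    unfolding word_row_def
    by (rule sum.mono_neutral_right[OF finite_length_eq])
      (auto simp: vec_at.rep_eq bounded_clinear_0 U lin)
  finally show ?thesis by (simp add: vec_at.rep_eq)
qed

lemma coord_Nil: "coord (W g) [] = cadjoint U g"
  by (rule inner_eqI) (simp add: inner_coord inner_cadjoint_left[OF U])

text \<open>The intertwining relation behind the whole argument: the coefficients at words
  \<open>k # \<sigma>\<close> are those of the wave operator applied to
  \<open>F\<^sub>k\<^sup>* g\<close>.\<close>

lemma branch_W: "branch k (W g) = W (cadjoint (F k) g)"
  by (rule l2_eqI, rule inner_eqI)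
    (simp add: inner_coord inner_cadjoint_left contraction_bounded_clinear F)

text \<open>The displacement equation for \<open>W\<^sup>*W\<close> in weak form.\<close>

lemma inner_W: "inner (W g) (W g') = inner (cadjoint U g) (cadjoint U g')
    + (\<Sum>k\<in>UNIV. inner (W (cadjoint (F k) g)) (W (cadjoint (F k) g')))"
  by (simp add: inner_fock[of "W g"] coord_Nil branch_W)

end

text \<open>The displacement equation for \<open>h\<^sup>*h = A\<close> is the equality of the norms of \<open>X g\<close> and \<open>Y g\<close> below, which
  yields the contractive colligation \<open>C\<close>.\<close>

lemma ex_schur_factor:
  fixes F :: "'n::finite \<Rightarrow> 'g::chilbert_space \<Rightarrow> 'g"
    and U :: "'e1::chilbert_space \<Rightarrow> 'g" and V :: "'e2::chilbert_space \<Rightarrow> 'g" and h :: "'g \<Rightarrow> 'g"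
  assumes "wave F U U_inf" and "wave F V V_inf" and h: "bounded_clinear h"
    and hsq: "\<And>g. (norm (h g))\<^sup>2 = (norm (U_inf g))\<^sup>2 - (norm (V_inf g))\<^sup>2"
  shows "\<exists>T\<in>schur_class. V_inf = T \<circ> U_inf"
proof -
  interpret U: wave F U U_inf by fact
  interpret V: wave F V V_inf by fact
  define X where "X g = (tuple (\<lambda>k. h (cadjoint (F k) g)), cadjoint U g)" for g
  define Y where "Y g = (h g, cadjoint V g)" for g
  have eq: "norm (Y g) = norm (X g)" for g
  proof -
    have "(norm (Y g))\<^sup>2 = (norm (X g))\<^sup>2"
      unfolding X_def Y_def norm_prod_sq fst_conv snd_conv norm_tuple_sq hsq sum_subtractf
      using U.inner_W[of g g] V.inner_W[of g g] by (simp add: power2_norm_eq_inner)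
    then show ?thesis by (simp add: power2_eq_iff_nonneg)
  qed
  note lin = h bounded_clinear_cadjoint[OF U.U] bounded_clinear_cadjoint[OF V.U]
    bounded_clinear_cadjoint[OF contraction_bounded_clinear[OF U.F]]
  have "bounded_linear Y"
    unfolding Y_def using lin by (intro bounded_linear_Pair) (auto simp: bounded_clinear_def)
  then have Y: "bounded_clinear Y"
    unfolding bounded_clinear_def by (simp add: Y_def scaleC_prod_def bounded_clinear_scaleC lin)
  obtain K where K: "\<And>g. norm (Y g) \<le> K * norm g"
    using bounded_clinear_bound[OF Y] by blast
  have X: "bounded_clinear X"
  proof (rule bounded_clinearI)
    \<comment> \<open>Boundedness of \<open>X\<close> is inherited from \<open>Y\<close> through
      equality of norms.\<close>
    show "norm (X g) \<le> K * norm g" for g using K[of g] by (simp add: eq)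
    show "X (g + g') = X g + X g'" for g g'
      by (simp add: X_def bounded_clinear_add lin tuple_add)
    show "X (c *\<^sub>C g) = c *\<^sub>C X g" for c g
      by (simp add: X_def bounded_clinear_scaleC lin tuple_scaleC scaleC_prod_def)
  qed
  obtain C where C: "contraction C" "\<And>g. C (X g) = Y g"
    using douglas_factorization[OF X Y] eq by auto
  obtain T where T: "T \<in> schur_class" "\<And>f. (\<lambda>m. transfer C m f) \<longlonglongrightarrow> T f"
    using ex_transfer_limit[OF C(1)] by blast
  \<comment> \<open>\<open>C\<close> maps \<open>X g\<close> to \<open>Y g\<close>, so
    \<open>h g\<close> is the exact state and \<open>V_inf g\<close> the exact output for input
    \<open>U_inf g\<close>; truncation only replaces the states at depth \<open>m\<close> by zero.
    For \<open>m = 0\<close> the bound is an equality, namely \<open>hsq\<close>.\<close>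
  have bound: "(norm (V_inf g - transfer C m (U_inf g)))\<^sup>2 + (norm (h g - state C m (U_inf g)))\<^sup>2
      \<le> tail m (U_inf g)" for m g
  proof (induction m arbitrary: g)
    case 0
    show ?case by (simp add: hsq)
  next
    case (Suc m)
    let ?G = "\<lambda>k. cadjoint (F k) g"
    let ?v = "(tuple (\<lambda>k. state C m (U_inf (?G k))), cadjoint U g)"
    have v: "X g - ?v = (tuple (\<lambda>k. h (?G k) - state C m (U_inf (?G k))), 0)"
      by (simp add: X_def tuple_diff)
    have V: "V_inf g = node (cadjoint V g) (\<lambda>k. V_inf (?G k))"
      by (rule fock_eqI) (simp_all add: V.coord_Nil V.branch_W)
    have "(norm (V_inf g - transfer C (Suc m) (U_inf g)))\<^sup>2 + (norm (h g - state C (Suc m) (U_inf g)))\<^sup>2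
      \<le> (norm (0::'e1))\<^sup>2 + (\<Sum>k\<in>UNIV. (norm (V_inf (?G k) - transfer C m (U_inf (?G k))))\<^sup>2
          + (norm (h (?G k) - state C m (U_inf (?G k))))\<^sup>2)"
      unfolding transfer.simps state.simps U.coord_Nil U.branch_W V node_diff[symmetric]
    proof (rule colligation_step[OF C(1)])
      show "C (tuple (\<lambda>k. h (?G k) - state C m (U_inf (?G k))), 0) =
          (h g - fst (C ?v), cadjoint V g - snd (C ?v))"
        unfolding v[symmetric] bounded_clinear_diff[OF contraction_bounded_clinear[OF C(1)]] C(2)
        by (simp add: Y_def prod_eq_iff)
    qed
    also have "\<dots> \<le> (norm (0::'e1))\<^sup>2 + (\<Sum>k\<in>UNIV. tail m (U_inf (?G k)))"
      by (intro add_left_mono sum_mono Suc)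
    finally show ?case by (simp add: U.branch_W)
  qed
  have "V_inf g = T (U_inf g)" for g
  proof -
    have "(\<lambda>m. (norm (V_inf g - transfer C m (U_inf g)))\<^sup>2) \<longlonglongrightarrow> 0"
    proof (rule Lim_null_comparison[OF always_eventually tail_tendsto_0], rule allI)
      fix m
      show "norm ((norm (V_inf g - transfer C m (U_inf g)))\<^sup>2) \<le> tail m (U_inf g)"
        unfolding real_norm_def abs_power2
        using bound[of g m] zero_le_power2[of "norm (h g - state C m (U_inf g))"] by linarith
    qed
    moreover have "(\<lambda>m. (norm (V_inf g - transfer C m (U_inf g)))\<^sup>2) \<longlonglongrightarrow> (norm (V_inf g - T (U_inf g)))\<^sup>2"
      by (intro tendsto_intros T)
    ultimately have "(norm (V_inf g - T (U_inf g)))\<^sup>2 = 0" by (rule LIMSEQ_unique[rotated])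
    then show ?thesis by simp
  qed
  then show ?thesis using T(1) by (intro bexI[of _ T]) auto
qed

text \<open>Iterating the equation \<open>d\<close> times expresses \<open>D g\<close> through words
  of length \<open>d\<close>. The outer factors are contractions, so the norm of \<open>D g\<close>
  is at most \<open>K\<close> times a sum that tends to zero.\<close>

lemma displacement_homogeneous_unique:
  fixes F :: "'n::finite \<Rightarrow> 'g::chilbert_space \<Rightarrow> 'g"
  assumes F: "\<And>k. contraction (F k)" and D: "bounded_clinear D"
    and lim: "\<And>g. (\<lambda>k. \<Sum>\<sigma> | length \<sigma> = k. norm (cadjoint (word_op F \<sigma>) g)) \<longlonglongrightarrow> 0"
    and eq: "\<And>g. D g = (\<Sum>k\<in>UNIV. F k (D (cadjoint (F k) g)))"
  shows "D g = 0"
proof -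
  obtain K where K: "0 < K" "\<And>x. norm (D x) \<le> K * norm x"
    using bounded_clinear_bound[OF D] by blast
  have le: "norm (D g) \<le> (\<Sum>\<sigma> | length \<sigma> = d. norm (D (cadjoint (word_op F \<sigma>) g)))" for d g
  proof (induction d arbitrary: g)
    case 0
    show ?case by (simp add: cadjoint_word_op_Nil del: word_op.simps)
  next
    case (Suc d)
    have "norm (D g) \<le> (\<Sum>k\<in>UNIV. norm (F k (D (cadjoint (F k) g))))"
      by (subst eq) (rule norm_sum)
    also have "\<dots> \<le> (\<Sum>k\<in>UNIV. norm (D (cadjoint (F k) g)))"
      using F by (intro sum_mono) (simp add: contraction_def)
    also have "\<dots> \<le> (\<Sum>k\<in>UNIV. \<Sum>\<sigma> | length \<sigma> = d. norm (D (cadjoint (word_op F \<sigma>) (cadjoint (F k) g))))"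
      by (intro sum_mono Suc)
    finally show ?case
      by (simp only: sum_length_Suc cadjoint_word_op_Cons[OF F])
  qed
  have "norm (D g) \<le> 0"
  proof (rule LIMSEQ_le_const)
    show "(\<lambda>d. K * (\<Sum>\<sigma> | length \<sigma> = d. norm (cadjoint (word_op F \<sigma>) g))) \<longlonglongrightarrow> 0"
      using tendsto_mult[OF tendsto_const lim[of g], of K] by simp
    have "norm (D g) \<le> K * (\<Sum>\<sigma> | length \<sigma> = d. norm (cadjoint (word_op F \<sigma>) g))" for d
      unfolding sum_distrib_left
      by (rule order_trans[OF le[of g d]]) (intro sum_mono K)
    then show "\<exists>N. \<forall>d\<ge>N. norm (D g) \<le> K * (\<Sum>\<sigma> | length \<sigma> = d. norm (cadjoint (word_op F \<sigma>) g))"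
      by blast
  qed
  then show ?thesis by simp
qed

lemma bounded_clinear_Pair_sum:
  assumes U: "bounded_clinear U" and V: "bounded_clinear V"
  shows "bounded_clinear (\<lambda>(x, y). U x + V y)"
proof -
  have "bounded_clinear (fst :: 'a \<times> 'c \<Rightarrow> _)" "bounded_clinear (snd :: 'a \<times> 'c \<Rightarrow> _)"
    unfolding bounded_clinear_def by (simp_all add: bounded_linear_fst bounded_linear_snd scaleC_prod_def)
  then show ?thesis
    unfolding case_prod_unfold
    by (intro bounded_clinear_plus bounded_clinear_compose[OF U] bounded_clinear_compose[OF V])
qed

theorem theorem3p1:
  fixes F :: "'n::finite \<Rightarrow> 'g::chilbert_space \<Rightarrow> 'g"
    and U :: "'e1::chilbert_space \<Rightarrow> 'g"
    and V :: "'e2::chilbert_space \<Rightarrow> 'g"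
    and G :: "'e1 \<times> 'e2 \<Rightarrow> 'g"
    and U_inf :: "'g \<Rightarrow> ('n, 'e1) fock"
    and V_inf :: "'g \<Rightarrow> ('n, 'e2) fock"
    and A :: "'g \<Rightarrow> 'g"
  assumes "\<And>k. contraction (F k)"
    and "bounded_clinear U" and "bounded_clinear V"
    and "G = (\<lambda>(x, y). U x + V y)"
    and "bounded_wave_operator F U U_inf"
    and "bounded_wave_operator F V V_inf"
    and "\<And>g. (\<lambda>k. \<Sum>\<sigma> | length \<sigma> = k. norm (cadjoint (word_op F \<sigma>) g)) \<longlonglongrightarrow> 0"
    and "A = (\<lambda>g. cadjoint U_inf (U_inf g) - cadjoint V_inf (V_inf g))"
  shows "(\<forall>B. solves_displacement F G B \<longleftrightarrow> B = A) \<and>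
    (positive_op A \<longleftrightarrow> (\<exists>T \<in> schur_class. V_inf = T \<circ> U_inf))"
proof (intro conjI allI iffI)
  have wU: "wave F U U_inf" and wV: "wave F V V_inf"
    using assms by (simp_all add: wave_def)
  interpret U: wave F U U_inf by fact
  interpret V: wave F V V_inf by fact
  note Flin = contraction_bounded_clinear[OF assms(1)]
  have A: "bounded_clinear A"
    unfolding assms(8)
    by (intro bounded_clinear_minus bounded_clinear_compose[OF bounded_clinear_cadjoint] U.W V.W)
  have A_form: "inner (A x) y = inner (U_inf x) (U_inf y) - inner (V_inf x) (V_inf y)" for x y
    by (simp add: assms(8) inner_diff_left inner_cadjoint_left U.W V.W)
  have A_solves: "solves_displacement F G A"
    unfolding solves_displacement_def
  proof (intro conjI allI A)
    fix g
    have "bounded_clinear G"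
      unfolding assms(4) by (intro bounded_clinear_Pair_sum assms)
    then have "cadjoint G g = (cadjoint U g, cadjoint V g)"
      by (rule cadjointI) (auto simp: assms(4) inner_cadjoint assms(2,3) inner_add_left)
    \<comment> \<open>\<open>GJG\<^sup>* = UU\<^sup>* - VV\<^sup>*\<close>.\<close>
    then have G: "G (signature_op (cadjoint G g)) = U (cadjoint U g) - V (cadjoint V g)"
      using bounded_clinear_diff[OF assms(3), of 0 "cadjoint V g"]
      by (simp add: assms(4) signature_op_def bounded_clinear_0[OF assms(3)])
    show "A g - (\<Sum>k\<in>UNIV. F k (A (cadjoint (F k) g))) = G (signature_op (cadjoint G g))"
    proof (rule inner_eqI)
      fix z
      have "inner (A g - (\<Sum>k\<in>UNIV. F k (A (cadjoint (F k) g)))) z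
          = inner (A g) z - (\<Sum>k\<in>UNIV. inner (A (cadjoint (F k) g)) (cadjoint (F k) z))"
        by (simp add: inner_diff_left inner_sum_left inner_cadjoint[OF Flin])
      \<comment> \<open>Subtract the two instances of \<open>inner_W\<close>; the sums over letters
        cancel.\<close>
      also have "\<dots> = inner (cadjoint U g) (cadjoint U z) - inner (cadjoint V g) (cadjoint V z)"
        unfolding A_form sum_subtractf U.inner_W[of g z] V.inner_W[of g z] by simp
      also have "\<dots> = inner (G (signature_op (cadjoint G g))) z"
        by (simp add: G inner_diff_left inner_cadjoint assms(2,3))
      finally show "inner (A g - (\<Sum>k\<in>UNIV. F k (A (cadjoint (F k) g)))) z
        = inner (G (signature_op (cadjoint G g))) z" .
    qed
  qed
  show "B = A" if "solves_displacement F G B" for B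
  proof
    fix g
    have B: "bounded_clinear B"
        "\<And>g. B g - (\<Sum>k\<in>UNIV. F k (B (cadjoint (F k) g))) = G (signature_op (cadjoint G g))"
      using that by (simp_all add: solves_displacement_def)
    have "B g - A g = 0"
    proof (rule displacement_homogeneous_unique[where F = F and D = "\<lambda>g. B g - A g"])
      show "bounded_clinear (\<lambda>g. B g - A g)" by (intro bounded_clinear_minus A B)
      show "B g - A g = (\<Sum>k\<in>UNIV. F k (B (cadjoint (F k) g) - A (cadjoint (F k) g)))" for g
      proof -
        have "B g - (\<Sum>k\<in>UNIV. F k (B (cadjoint (F k) g)))
            = A g - (\<Sum>k\<in>UNIV. F k (A (cadjoint (F k) g)))"
          using A_solves unfolding solves_displacement_def by (simp only: B(2))
        then show ?thesis
          unfolding bounded_clinear_diff[OF Flin] sum_subtractf by (simp add: algebra_simps)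
      qed
    qed (rule assms)+
    then show "B g = A g" by simp
  qed
  show "solves_displacement F G B" if "B = A" for B
    using that A_solves by simp
  show "\<exists>T\<in>schur_class. V_inf = T \<circ> U_inf" if pos: "positive_op A"
  proof -
    \<comment> \<open>Self-adjointness is visible from \<open>A_form\<close>, whose right-hand side
      is symmetric.\<close>
    have sym: "inner (A x) y = inner x (A y)" for x y
      using A_form[of x y] A_form[of y x] by (simp add: inner_commute)
    have "0 \<le> inner (A x) x" for x
      using pos by (simp add: positive_op_def Re_cinner)
    from positive_square_root[OF A sym this] obtain h :: "'g \<Rightarrow> 'g"
      where h: "bounded_clinear h" "\<And>x. (norm (h x))\<^sup>2 = inner (A x) x" by blast
    show ?thesis
      by (rule ex_schur_factor[OF wU wV h(1)], unfold h(2) A_form) (simp add: power2_norm_eq_inner)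
  qed
  show "positive_op A" if "\<exists>T\<in>schur_class. V_inf = T \<circ> U_inf"
  proof -
    obtain T :: "('n, 'e1) fock \<Rightarrow> ('n, 'e2) fock" where T: "contraction T" "V_inf = T \<circ> U_inf"
      using \<open>\<exists>T\<in>schur_class. V_inf = T \<circ> U_inf\<close> unfolding schur_class_def by blast
    \<comment> \<open>The imaginary part vanishes because \<open>\<i> *\<^sub>C y\<close> is
      orthogonal to \<open>y\<close> for the real inner product.\<close>
    have "cinner (A x) x = complex_of_real ((norm (U_inf x))\<^sup>2 - (norm (V_inf x))\<^sup>2)" for x
      by (simp add: inner_scaleC_i cinner_conv_inner bounded_clinear_scaleC[OF A, symmetric] A_form
            bounded_clinear_scaleC[OF U.W] bounded_clinear_scaleC[OF V.W] power2_norm_eq_inner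
            complex_eq_iff)
    moreover have "(norm (V_inf x))\<^sup>2 \<le> (norm (U_inf x))\<^sup>2" for x
      using T by (intro power_mono) (simp_all add: contraction_def)
    ultimately show ?thesis unfolding positive_op_def using A by simp
  qed
qed

end
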